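(* Let $(T_t)_{t\ge0}$ be an individually eventually positive $C_0$-semigroup on a (complex) $(\mathrm{AL})$-space $X$. Assume that $(T_t)_{t\ge0}$ is Kreiss bounded. Then there exists $\epsilon\in(0,1)$ such that, as $t\to+\infty$, $$\|T_t\|=\mathcal{O}(t^{1-\epsilon}).$$
   Context: A (complex) Banach lattice is the complexification $X=X_{\mathbb{R}}+iX_{\mathbb{R}}$ of a real Banach lattice $X_{\mathbb{R}}$, with positive cone $X_+$. A Banach lattice $X$ is an $(\mathrm{AL})$-space if $\|x+y\|=\|x\|+\|y\|$ for all $x,y\in X_+$. Let $-A$ denote the generator of a $C_0$-semigroup $(T_t)_{t\ge0}$ on a complex Banach space $X$. Write $\mathbb{C}_+=\{\lambda\in\mathbb{C}:\operatorname{Re}\lambda>0\}$, $\mathbb{C}_-=\{\lambda\in\mathbb{C}:\operatorname{Re}\lambda<0\}$, $\rho(A)$ for the resolvent set of $A$ and $R(\mu,A)=(\mu-A)^{-1}$ for $\mu\in\rho(A)$. The semigroup is Kreiss bounded if $\mathbb{C}_-\subseteq\rho(A)$ and there is a constant $C$ such that $\|R(-\lambda,A)\|\le C/\operatorname{Re}(\lambda)$ for every $\lambda\in\mathbb{C}_+$. The semigroup is individually eventually positive if for every $x\in X_+$ there exists $t_x\ge0$ such that $T_tx\in X_+$ for every $t\ge t_x$. *)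

theory Defs
  imports "HOL-Analysis.Analysis" "HOL-Library.Lattice_Algebras" "HOL-Library.Landau_Symbols"
begin

section \<open>Real Banach lattices and (AL)-spaces\<close>

class banach_lattice = banach + ordered_real_vector + lattice_ab_group_add_abs +
  assumes norm_mono_abs: "\<bar>x\<bar> \<le> \<bar>y\<bar> \<Longrightarrow> norm x \<le> norm y"

class al_space = banach_lattice +
  assumes norm_add_nonneg: "0 \<le> x \<Longrightarrow> 0 \<le> y \<Longrightarrow> norm (x + y) = norm x + norm y"

instance real :: al_space
  by standard auto


section \<open>Complex Banach spaces\<close>

class complex_banach = banach +
  fixes scaleC :: "complex \<Rightarrow> 'a \<Rightarrow> 'a"  (infixr "*\<^sub>C" 75)
  assumes scaleC_add_right: "a *\<^sub>C (x + y) = a *\<^sub>C x + a *\<^sub>C y"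
    and scaleC_add_left: "(a + b) *\<^sub>C x = a *\<^sub>C x + b *\<^sub>C x"
    and scaleC_scaleC: "a *\<^sub>C b *\<^sub>C x = (a * b) *\<^sub>C x"
    and scaleC_of_real: "of_real r *\<^sub>C x = r *\<^sub>R x"
    and norm_scaleC: "norm (a *\<^sub>C x) = cmod a * norm x"

definition bounded_clinear :: "('a::complex_banach \<Rightarrow> 'b::complex_banach) \<Rightarrow> bool" where
  "bounded_clinear f \<longleftrightarrow> bounded_linear f \<and> (\<forall>c x. f (c *\<^sub>C x) = c *\<^sub>C f x)"


section \<open>The complexification of a Banach lattice\<close>

text \<open>\<open>Cplx x y\<close> stands for $x + i y$.\<close>

datatype 'a complexification = Cplx (re_part: 'a) (im_part: 'a)

text \<open>The modulus $|x + i y| = \sup_\theta (x \cos\theta + y \sin\theta)$. A Banach lattice need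
  not be order complete, but this supremum always exists, see \<open>cmodulus_upper\<close> and
  \<open>cmodulus_least\<close> below.\<close>

definition cmodulus :: "'a::banach_lattice complexification \<Rightarrow> 'a" where
  "cmodulus z = (LEAST m. \<forall>\<theta>. cos \<theta> *\<^sub>R re_part z + sin \<theta> *\<^sub>R im_part z \<le> m)"

lemma banach_lattice_nonneg_closed:
  fixes x :: "'a::banach_lattice"
  assumes "\<And>n. 0 \<le> X n" and "X \<longlonglongrightarrow> x"
  shows "0 \<le> x"
proof -
  have *: "norm (sup (-x) 0) \<le> norm (X n - x)" for n
  proof (rule norm_mono_abs)
    have "- x \<le> \<bar>X n - x\<bar>"
      using assms(1)[of n] abs_ge_self[of "X n - x"]
      by (metis add_increasing diff_conv_add_uminus order_refl order_trans)
    then have "sup (-x) 0 \<le> \<bar>X n - x\<bar>" by simp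
    then show "\<bar>sup (-x) 0\<bar> \<le> \<bar>X n - x\<bar>" by simp
  qed
  have "(\<lambda>n. norm (X n - x)) \<longlonglongrightarrow> 0"
    using assms(2) LIM_zero tendsto_norm_zero by blast
  then have "norm (sup (-x) 0) \<le> 0"
    using * by (meson LIMSEQ_le_const)
  then have "sup (-x) 0 = 0" by simp
  then show ?thesis
    by (metis neg_le_0_iff_le sup.cobounded1)
qed

lemma banach_lattice_lim_le:
  fixes x y :: "'a::banach_lattice"
  assumes "\<And>n. X n \<le> Y n" "X \<longlonglongrightarrow> x" "Y \<longlonglongrightarrow> y"
  shows "x \<le> y"
  using banach_lattice_nonneg_closed[of "\<lambda>n. Y n - X n" "y - x"] assms
  by (simp add: tendsto_diff)

lemma scaleR_le_abs:
  fixes x :: "'a::banach_lattice"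
  shows "c *\<^sub>R x \<le> \<bar>c\<bar> *\<^sub>R \<bar>x\<bar>"
proof (cases "c \<ge> 0")
  case True
  then show ?thesis by (simp add: scaleR_left_mono abs_ge_self)
next
  case False
  then have "(-c) *\<^sub>R (-x) \<le> (-c) *\<^sub>R \<bar>x\<bar>"
    by (intro scaleR_left_mono abs_ge_minus_self) auto
  then show ?thesis using False by simp
qed

lemma cmodulus_lub_exists:
  fixes x y :: "'a::banach_lattice"
  shows "\<exists>m. (\<forall>\<theta>. cos \<theta> *\<^sub>R x + sin \<theta> *\<^sub>R y \<le> m) \<and>
             (\<forall>u. (\<forall>\<theta>. cos \<theta> *\<^sub>R x + sin \<theta> *\<^sub>R y \<le> u) \<longrightarrow> m \<le> u)"
proof -
  define f where "f \<theta> = cos \<theta> *\<^sub>R x + sin \<theta> *\<^sub>R y" for \<theta>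
  define e where "e = \<bar>x\<bar> + \<bar>y\<bar>"
  have e0: "0 \<le> e" by (simp add: e_def)
  have lip: "f a \<le> f b + \<bar>a - b\<bar> *\<^sub>R e" for a b
  proof -
    have c: "\<bar>cos a - cos b\<bar> \<le> \<bar>a - b\<bar>" and s: "\<bar>sin a - sin b\<bar> \<le> \<bar>a - b\<bar>"
    proof -
      have "\<bar>cos a - cos b\<bar> \<le> 1 * \<bar>a - b\<bar>"
        using field_differentiable_bound[of UNIV cos "\<lambda>x. - sin x" 1 a b]
        by (auto intro!: derivative_eq_intros simp: abs_sin_le_one)
      then show "\<bar>cos a - cos b\<bar> \<le> \<bar>a - b\<bar>" by simp
      have "\<bar>sin a - sin b\<bar> \<le> 1 * \<bar>a - b\<bar>"
        using field_differentiable_bound[of UNIV sin "\<lambda>x. cos x" 1 a b]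
        by (auto intro!: derivative_eq_intros simp: abs_cos_le_one)
      then show "\<bar>sin a - sin b\<bar> \<le> \<bar>a - b\<bar>" by simp
    qed
    have "f a - f b = (cos a - cos b) *\<^sub>R x + (sin a - sin b) *\<^sub>R y"
      by (simp add: f_def algebra_simps)
    also have "\<dots> \<le> \<bar>cos a - cos b\<bar> *\<^sub>R \<bar>x\<bar> + \<bar>sin a - sin b\<bar> *\<^sub>R \<bar>y\<bar>"
      by (intro add_mono scaleR_le_abs)
    also have "\<dots> \<le> \<bar>a - b\<bar> *\<^sub>R \<bar>x\<bar> + \<bar>a - b\<bar> *\<^sub>R \<bar>y\<bar>"
      by (intro add_mono scaleR_right_mono c s) auto
    finally have "f a - f b \<le> \<bar>a - b\<bar> *\<^sub>R e" by (simp add: e_def scaleR_add_right)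
    then show ?thesis by (simp add: diff_le_eq add.commute)
  qed
  define d where "d n = 2 * pi / 2 ^ n" for n :: nat
  define G where "G n = (\<lambda>k. f (real k * d n)) ` {..(2::nat) ^ n}" for n :: nat
  define s where "s n = Sup_fin (G n)" for n
  have G: "finite (G n)" "G n \<noteq> {}" for n by (auto simp: G_def)
  have dpos: "d n > 0" for n by (simp add: d_def)
  have dlim: "d \<longlonglongrightarrow> 0"
  proof -
    have "(\<lambda>n. 2 * pi * (1 / 2) ^ n) \<longlonglongrightarrow> 2 * pi * 0"
      by (intro tendsto_mult tendsto_const LIMSEQ_power_zero) auto
    moreover have "d = (\<lambda>n. 2 * pi * (1 / 2) ^ n)" by (auto simp: d_def power_divide)
    ultimately show ?thesis by simp
  qed
  have up: "f \<theta> \<le> s n + d n *\<^sub>R e" for \<theta> n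
  proof -
    obtain \<phi> where \<phi>: "0 \<le> \<phi>" "\<phi> < 2 * pi" "cos \<theta> = cos \<phi>" "sin \<theta> = sin \<phi>"
      using sincos_total_2pi[of "cos \<theta>" "sin \<theta>"] by (metis sin_cos_squared_add2 add.commute)
    define k where "k = nat \<lfloor>\<phi> / d n\<rfloor>"
    have "real k \<le> \<phi> / d n" "\<phi> / d n < real k + 1"
      using \<phi>(1) dpos[of n] by (auto simp: k_def)
    then have k: "real k * d n \<le> \<phi>" "\<phi> \<le> real k * d n + d n"
      using dpos[of n] by (auto simp: field_simps)
    have "real k * d n < 2 ^ n * d n" using k(1) \<phi>(2) by (simp add: d_def)
    then have "real k < 2 ^ n" using dpos[of n] by simp
    then have "k \<le> 2 ^ n" by (metis less_imp_le of_nat_less_numeral_power_cancel_iff)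
    then have "f (real k * d n) \<in> G n" by (auto simp: G_def)
    then have "f (real k * d n) \<le> s n" unfolding s_def using G by (simp add: Sup_fin.coboundedI)
    moreover have "f \<phi> \<le> f (real k * d n) + \<bar>\<phi> - real k * d n\<bar> *\<^sub>R e" by (rule lip)
    moreover have "\<bar>\<phi> - real k * d n\<bar> *\<^sub>R e \<le> d n *\<^sub>R e"
      using k e0 by (intro scaleR_right_mono) auto
    moreover have "f \<theta> = f \<phi>" using \<phi> by (simp add: f_def)
    ultimately show ?thesis by (metis add_mono order_trans)
  qed
  have sle: "s n \<le> u" if "\<And>\<theta>. f \<theta> \<le> u" for n u
    unfolding s_def using G that by (intro Sup_fin.boundedI) (auto simp: G_def)
  have ss: "s m \<le> s n + d n *\<^sub>R e" for m n by (rule sle[OF up])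
  have "Cauchy s"
  proof (rule metric_CauchyI)
    fix \<epsilon> :: real assume "\<epsilon> > 0"
    have "(\<lambda>n. d n * norm e) \<longlonglongrightarrow> 0 * norm e" by (intro tendsto_mult dlim tendsto_const)
    then have "(\<lambda>n. d n * norm e) \<longlonglongrightarrow> 0" by simp
    from LIMSEQ_D[OF this \<open>\<epsilon> > 0\<close>] obtain N where N: "\<And>n. n \<ge> N \<Longrightarrow> d n * norm e < \<epsilon>"
      by (metis abs_less_iff diff_zero real_norm_def)
    have "dist (s m) (s n) < \<epsilon>" if "m \<ge> N" "n \<ge> N" for m n
    proof -
      have dm: "d k \<le> d N" if "k \<ge> N" for k
        using that by (simp add: d_def frac_le power_increasing)
      have le: "s a - s b \<le> d N *\<^sub>R e" if "b \<ge> N" for a b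
      proof -
        have "s a - s b \<le> d b *\<^sub>R e" using ss[of a b] by (simp add: diff_le_eq add.commute)
        also have "\<dots> \<le> d N *\<^sub>R e" using dm[OF that] e0 by (intro scaleR_right_mono)
        finally show ?thesis .
      qed
      have "\<bar>s m - s n\<bar> \<le> d N *\<^sub>R e"
        using le[OF that(1), of n] le[OF that(2), of m] by (intro abs_leI) auto
      also have "\<dots> \<le> \<bar>d N *\<^sub>R e\<bar>" by (rule abs_ge_self)
      finally have "norm (s m - s n) \<le> norm (d N *\<^sub>R e)" by (rule norm_mono_abs)
      then show ?thesis using N[of N] dpos[of N] by (simp add: dist_norm)
    qed
    then show "\<exists>M. \<forall>m\<ge>M. \<forall>n\<ge>M. dist (s m) (s n) < \<epsilon>" by blast
  qed
  then obtain m where m: "s \<longlonglongrightarrow> m" using Cauchy_convergent convergent_def by blast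
  have "f \<theta> \<le> m" for \<theta>
  proof (rule banach_lattice_lim_le)
    show "f \<theta> \<le> s n + d n *\<^sub>R e" for n by (rule up)
    have "(\<lambda>n. s n + d n *\<^sub>R e) \<longlonglongrightarrow> m + 0 *\<^sub>R e"
      by (intro tendsto_intros m dlim)
    then show "(\<lambda>n. s n + d n *\<^sub>R e) \<longlonglongrightarrow> m" by simp
  qed simp
  moreover have "m \<le> u" if "\<And>\<theta>. f \<theta> \<le> u" for u
    using banach_lattice_lim_le[of s "\<lambda>_. u" m u] sle[OF that] m by simp
  ultimately show ?thesis unfolding f_def by blast
qed

lemma cmodulus_upper: "cos \<theta> *\<^sub>R re_part z + sin \<theta> *\<^sub>R im_part z \<le> cmodulus z"
  and cmodulus_least:
    "(\<And>\<theta>. cos \<theta> *\<^sub>R re_part z + sin \<theta> *\<^sub>R im_part z \<le> u) \<Longrightarrow> cmodulus z \<le> u"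
proof -
  obtain m where m: "\<forall>\<theta>. cos \<theta> *\<^sub>R re_part z + sin \<theta> *\<^sub>R im_part z \<le> m"
      "\<forall>u. (\<forall>\<theta>. cos \<theta> *\<^sub>R re_part z + sin \<theta> *\<^sub>R im_part z \<le> u) \<longrightarrow> m \<le> u"
    using cmodulus_lub_exists by blast
  have "cmodulus z = m" unfolding cmodulus_def by (rule Least_equality) (use m in auto)
  then show "cos \<theta> *\<^sub>R re_part z + sin \<theta> *\<^sub>R im_part z \<le> cmodulus z"
    "(\<And>\<theta>. cos \<theta> *\<^sub>R re_part z + sin \<theta> *\<^sub>R im_part z \<le> u) \<Longrightarrow> cmodulus z \<le> u"
    using m by auto
qed

lemma cmodulus_eqI:
  assumes "\<And>\<theta>. cos \<theta> *\<^sub>R re_part z + sin \<theta> *\<^sub>R im_part z \<le> m"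
    and "\<And>u. (\<And>\<theta>. cos \<theta> *\<^sub>R re_part z + sin \<theta> *\<^sub>R im_part z \<le> u) \<Longrightarrow> m \<le> u"
  shows "cmodulus z = m"
  by (intro order_antisym cmodulus_least assms cmodulus_upper)

lemma abs_re_le_cmodulus: "\<bar>re_part z\<bar> \<le> cmodulus z"
  using cmodulus_upper[of 0 z] cmodulus_upper[of pi z] by (intro abs_leI) auto

lemma abs_im_le_cmodulus: "\<bar>im_part z\<bar> \<le> cmodulus z"
  using cmodulus_upper[of "pi/2" z] cmodulus_upper[of "-(pi/2)" z]
  by (intro abs_leI) (simp_all del: divide_minus_left)

lemma cmodulus_nonneg: "0 \<le> cmodulus z"
  using abs_re_le_cmodulus[of z] abs_ge_zero order_trans by blast

lemma abs_cmodulus [simp]: "\<bar>cmodulus z\<bar> = cmodulus z"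
  by (simp add: cmodulus_nonneg)

lemma cmodulus_le_abs: "cmodulus z \<le> \<bar>re_part z\<bar> + \<bar>im_part z\<bar>"
proof (rule cmodulus_least)
  fix \<theta>
  have "c *\<^sub>R x \<le> \<bar>x\<bar>" if "\<bar>c\<bar> \<le> 1" for c :: real and x :: 'a
    using scaleR_le_abs[of c x] scaleR_right_mono[OF that, of "\<bar>x\<bar>"] by auto
  then show "cos \<theta> *\<^sub>R re_part z + sin \<theta> *\<^sub>R im_part z \<le> \<bar>re_part z\<bar> + \<bar>im_part z\<bar>"
    by (intro add_mono) auto
qed

lemma cmodulus_real: "cmodulus (Cplx x 0) = \<bar>x\<bar>"
  using cmodulus_le_abs[of "Cplx x 0"] abs_re_le_cmodulus[of "Cplx x 0"] by simp

lemma cmodulus_mult: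
  "cmodulus (Cplx (Re c *\<^sub>R re_part z - Im c *\<^sub>R im_part z)
                  (Im c *\<^sub>R re_part z + Re c *\<^sub>R im_part z)) = cmod c *\<^sub>R cmodulus z"
  (is "cmodulus ?cz = _")
proof -
  obtain \<alpha> where "c = rcis (cmod c) \<alpha>" by (metis rcis_cmod_Arg)
  define r where "r = cmod c"
  have Re: "Re c = r * cos \<alpha>" and Im: "Im c = r * sin \<alpha>"
    using \<open>c = rcis (cmod c) \<alpha>\<close> unfolding r_def by (metis Re_rcis, metis Im_rcis)
  have r0: "r \<ge> 0" by (simp add: r_def)
  have rot: "cos \<theta> *\<^sub>R re_part ?cz + sin \<theta> *\<^sub>R im_part ?cz
      = r *\<^sub>R (cos (\<theta> - \<alpha>) *\<^sub>R re_part z + sin (\<theta> - \<alpha>) *\<^sub>R im_part z)" for \<theta>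
    by (simp add: Re Im cos_diff sin_diff algebra_simps)
  have "cmodulus ?cz = r *\<^sub>R cmodulus z"
  proof (rule cmodulus_eqI)
    fix \<theta>
    show "cos \<theta> *\<^sub>R re_part ?cz + sin \<theta> *\<^sub>R im_part ?cz \<le> r *\<^sub>R cmodulus z"
      unfolding rot by (intro scaleR_left_mono cmodulus_upper r0)
  next
    fix u assume u: "\<And>\<theta>. cos \<theta> *\<^sub>R re_part ?cz + sin \<theta> *\<^sub>R im_part ?cz \<le> u"
    have u': "r *\<^sub>R (cos \<theta> *\<^sub>R re_part z + sin \<theta> *\<^sub>R im_part z) \<le> u" for \<theta>
      using u[of "\<theta> + \<alpha>"] unfolding rot by simp
    show "r *\<^sub>R cmodulus z \<le> u"
    proof (cases "r = 0")
      case True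
      then show ?thesis using u'[of 0] by simp
    next
      case False
      then have r: "r > 0" using r0 by simp
      have "cmodulus z \<le> inverse r *\<^sub>R u"
      proof (rule cmodulus_least)
        fix \<theta>
        show "cos \<theta> *\<^sub>R re_part z + sin \<theta> *\<^sub>R im_part z \<le> inverse r *\<^sub>R u"
          using scaleR_left_mono[OF u'[of \<theta>], of "inverse r"] r by simp
      qed
      then show ?thesis using scaleR_left_mono[of "cmodulus z" "inverse r *\<^sub>R u" r] r by simp
    qed
  qed
  then show ?thesis by (simp add: r_def)
qed

instantiation complexification :: (banach_lattice) real_normed_vector
begin

definition "0 = Cplx 0 0"
definition "z + w = Cplx (re_part z + re_part w) (im_part z + im_part w)"
definition "- z = Cplx (- re_part z) (- im_part z)"
definition "z - w = Cplx (re_part z - re_part w) (im_part z - im_part w)"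
definition "r *\<^sub>R z = Cplx (r *\<^sub>R re_part z) (r *\<^sub>R im_part z)"
definition "norm z = norm (cmodulus z)"

definition "sgn z = inverse (norm z) *\<^sub>R z" for z :: "'a complexification"
definition "dist z w = norm (z - w)" for z w :: "'a complexification"
definition [code del]:
  "(uniformity :: ('a complexification \<times> 'a complexification) filter) =
     (INF e\<in>{0<..}. principal {(z, w). dist z w < e})"
definition [code del]:
  "open U \<longleftrightarrow> (\<forall>z\<in>U. \<forall>\<^sub>F (z', w) in uniformity. z' = z \<longrightarrow> w \<in> U)"
    for U :: "'a complexification set"

lemmas complexification_simps =
  zero_complexification_def plus_complexification_def uminus_complexification_def
  minus_complexification_def scaleR_complexification_def

lemma norm_re_part_le: "norm (re_part z) \<le> norm z"
  and norm_im_part_le: "norm (im_part z) \<le> norm z"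
  and norm_le_re_im: "norm z \<le> norm (re_part z) + norm (im_part z)"
  for z :: "'a complexification"
proof -
  show "norm (re_part z) \<le> norm z" "norm (im_part z) \<le> norm z"
    unfolding norm_complexification_def
    by (auto intro!: norm_mono_abs abs_re_le_cmodulus abs_im_le_cmodulus)
  have *: "norm \<bar>x\<bar> \<le> norm x" for x :: 'a by (rule norm_mono_abs) simp
  have "norm z \<le> norm (\<bar>re_part z\<bar> + \<bar>im_part z\<bar>)"
    unfolding norm_complexification_def
    by (rule norm_mono_abs) (simp add: cmodulus_le_abs)
  also have "\<dots> \<le> norm (re_part z) + norm (im_part z)"
    using norm_triangle_ineq[of "\<bar>re_part z\<bar>" "\<bar>im_part z\<bar>"] *[of "re_part z"] *[of "im_part z"]
    by linarith
  finally show "norm z \<le> norm (re_part z) + norm (im_part z)" .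
qed

instance
proof
  fix a b c :: "'a complexification" and r s :: real
  show "a + b + c = a + (b + c)" "a + b = b + a" "0 + a = a" "- a + a = 0" "a - b = a + - b"
    "r *\<^sub>R (a + b) = r *\<^sub>R a + r *\<^sub>R b" "(r + s) *\<^sub>R a = r *\<^sub>R a + s *\<^sub>R a"
    "r *\<^sub>R s *\<^sub>R a = (r * s) *\<^sub>R a" "1 *\<^sub>R a = a"
    by (simp_all add: complexification_simps algebra_simps)
  show "dist a b = norm (a - b)" by (rule dist_complexification_def)
  show "sgn a = inverse (norm a) *\<^sub>R a" by (rule sgn_complexification_def)
  show "(uniformity :: ('a complexification \<times> 'a complexification) filter) =
     (INF e\<in>{0<..}. principal {(z, w). dist z w < e})"
    by (rule uniformity_complexification_def)
  show "open U \<longleftrightarrow> (\<forall>z\<in>U. \<forall>\<^sub>F (z', w) in uniformity. z' = z \<longrightarrow> w \<in> U)"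
    for U :: "'a complexification set"
    by (rule open_complexification_def)
  show "norm a = 0 \<longleftrightarrow> a = 0"
  proof
    assume "norm a = 0"
    then show "a = 0" using norm_re_part_le[of a] norm_im_part_le[of a]
      by (simp add: complexification_simps complexification.expand)
  next
    assume "a = 0"
    then show "norm a = 0" using norm_le_re_im[of a]
      by (simp add: complexification_simps) (simp add: norm_complexification_def)
  qed
  show "norm (a + b) \<le> norm a + norm b"
  proof -
    have "cmodulus (a + b) \<le> cmodulus a + cmodulus b"
    proof (rule cmodulus_least)
      fix \<theta>
      have "cos \<theta> *\<^sub>R re_part (a + b) + sin \<theta> *\<^sub>R im_part (a + b)
        = (cos \<theta> *\<^sub>R re_part a + sin \<theta> *\<^sub>R im_part a) + (cos \<theta> *\<^sub>R re_part b + sin \<theta> *\<^sub>R im_part b)"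
        by (simp add: complexification_simps algebra_simps)
      also have "\<dots> \<le> cmodulus a + cmodulus b" by (intro add_mono cmodulus_upper)
      finally show "cos \<theta> *\<^sub>R re_part (a + b) + sin \<theta> *\<^sub>R im_part (a + b) \<le> cmodulus a + cmodulus b" .
    qed
    then have "norm (a + b) \<le> norm (cmodulus a + cmodulus b)"
      unfolding norm_complexification_def
      by (intro norm_mono_abs) (simp add: cmodulus_nonneg)
    also have "\<dots> \<le> norm a + norm b"
      unfolding norm_complexification_def by (rule norm_triangle_ineq)
    finally show ?thesis .
  qed
  show "norm (r *\<^sub>R a) = \<bar>r\<bar> * norm a"
    using cmodulus_mult[of "of_real r" a]
    by (simp add: norm_complexification_def scaleR_complexification_def)
qed

end

instantiation complexification :: (banach_lattice) complex_banach
begin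

definition "c *\<^sub>C z = Cplx (Re c *\<^sub>R re_part z - Im c *\<^sub>R im_part z)
                       (Im c *\<^sub>R re_part z + Re c *\<^sub>R im_part z)"

instance
proof
  fix a b :: "'a complexification" and r :: real and c1 c2 :: complex
  show "of_real r *\<^sub>C a = r *\<^sub>R a"
    by (simp add: complexification_simps scaleC_complexification_def)
  show "norm (c1 *\<^sub>C a) = cmod c1 * norm a"
    by (simp add: norm_complexification_def scaleC_complexification_def cmodulus_mult)
  show "c1 *\<^sub>C (a + b) = c1 *\<^sub>C a + c1 *\<^sub>C b" "(c1 + c2) *\<^sub>C a = c1 *\<^sub>C a + c2 *\<^sub>C a"
    "c1 *\<^sub>C c2 *\<^sub>C a = (c1 * c2) *\<^sub>C a"
    by (simp_all add: complexification_simps scaleC_complexification_def algebra_simps)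
next
  fix X :: "nat \<Rightarrow> 'a complexification"
  assume X: "Cauchy X"
  have "Cauchy (\<lambda>n. re_part (X n))" "Cauchy (\<lambda>n. im_part (X n))"
  proof -
    have *: "dist (re_part z) (re_part w) \<le> dist z w" "dist (im_part z) (im_part w) \<le> dist z w"
      for z w :: "'a complexification"
      using norm_re_part_le[of "z - w"] norm_im_part_le[of "z - w"]
      by (simp_all add: dist_norm dist_complexification_def complexification_simps)
    show "Cauchy (\<lambda>n. re_part (X n))" "Cauchy (\<lambda>n. im_part (X n))"
      using X * unfolding Cauchy_def by (meson order_le_less_trans)+
  qed
  then obtain x y where xy: "(\<lambda>n. re_part (X n)) \<longlonglongrightarrow> x" "(\<lambda>n. im_part (X n)) \<longlonglongrightarrow> y"
    by (meson Cauchy_convergent convergent_def)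
  have le: "dist (X n) (Cplx x y) \<le> norm (re_part (X n) - x) + norm (im_part (X n) - y)" for n
    using norm_le_re_im[of "X n - Cplx x y"]
    by (simp add: dist_complexification_def complexification_simps)
  have "(\<lambda>n. norm (re_part (X n) - x) + norm (im_part (X n) - y)) \<longlonglongrightarrow> 0 + 0"
    by (intro tendsto_add tendsto_norm_zero LIM_zero xy)
  then have lim: "(\<lambda>n. norm (re_part (X n) - x) + norm (im_part (X n) - y)) \<longlonglongrightarrow> 0" by simp
  have "(\<lambda>n. dist (X n) (Cplx x y)) \<longlonglongrightarrow> 0"
    by (rule tendsto_sandwich[OF _ _ tendsto_const lim])
       (auto simp: le zero_le_dist)
  then have "X \<longlonglongrightarrow> Cplx x y" by (rule tendsto_dist_iff[THEN iffD2])
  then show "convergent X" unfolding convergent_def by blast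
qed

end

definition positive_cone :: "'a::banach_lattice complexification set" where
  "positive_cone = {Cplx x 0 |x. 0 \<le> x}"

lemma norm_Cplx_real: "norm (Cplx x 0) = norm x"
  by (simp add: norm_complexification_def cmodulus_real) (intro antisym norm_mono_abs; simp)

lemma norm_add_positive_cone:
  fixes z w :: "'a::al_space complexification"
  assumes "z \<in> positive_cone" "w \<in> positive_cone"
  shows "norm (z + w) = norm z + norm w"
  using assms by (auto simp: positive_cone_def plus_complexification_def norm_Cplx_real norm_add_nonneg)


section \<open>Semigroups and their generators\<close>

text \<open>Only the values \<open>T t\<close> with \<open>0 \<le> t\<close> matter.\<close>

definition C0_semigroup :: "(real \<Rightarrow> 'a::complex_banach \<Rightarrow> 'a) \<Rightarrow> bool" where
  "C0_semigroup T \<longleftrightarrow>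
     (\<forall>t\<ge>0. bounded_clinear (T t)) \<and>
     T 0 = id \<and>
     (\<forall>s\<ge>0. \<forall>t\<ge>0. T (s + t) = T s \<circ> T t) \<and>
     (\<forall>x. ((\<lambda>t. T t x) \<longlongrightarrow> x) (at_right 0))"

definition generator_domain :: "(real \<Rightarrow> 'a::complex_banach \<Rightarrow> 'a) \<Rightarrow> 'a set" where
  "generator_domain T = {x. \<exists>y. ((\<lambda>h. (T h x - x) /\<^sub>R h) \<longlongrightarrow> y) (at_right 0)}"

text \<open>Meaningful only on \<open>generator_domain T\<close>.\<close>

definition generator :: "(real \<Rightarrow> 'a::complex_banach \<Rightarrow> 'a) \<Rightarrow> 'a \<Rightarrow> 'a" where
  "generator T x = Lim (at_right 0) (\<lambda>h. (T h x - x) /\<^sub>R h)"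

text \<open>An unbounded operator is given by its domain \<open>D\<close> and a map \<open>A\<close>, whose values outside \<open>D\<close>
  are irrelevant.\<close>

definition resolvent :: "'a::complex_banach set \<Rightarrow> ('a \<Rightarrow> 'a) \<Rightarrow> complex \<Rightarrow> 'a \<Rightarrow> 'a" where
  "resolvent D A \<mu> = the_inv_into D (\<lambda>x. \<mu> *\<^sub>C x - A x)"

definition resolvent_set :: "'a::complex_banach set \<Rightarrow> ('a \<Rightarrow> 'a) \<Rightarrow> complex set" where
  "resolvent_set D A =
     {\<mu>. bij_betw (\<lambda>x. \<mu> *\<^sub>C x - A x) D UNIV \<and> bounded_clinear (resolvent D A \<mu>)}"

text \<open>The sign convention is that \<open>-A\<close> generates \<open>T\<close>.\<close>

definition Kreiss_bounded :: "(real \<Rightarrow> 'a::complex_banach \<Rightarrow> 'a) \<Rightarrow> bool" where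
  "Kreiss_bounded T \<longleftrightarrow>
     (let D = generator_domain T; A = (\<lambda>x. - generator T x) in
       {\<mu>. Re \<mu> < 0} \<subseteq> resolvent_set D A \<and>
       (\<exists>C. \<forall>\<mu>. 0 < Re \<mu> \<longrightarrow> onorm (resolvent D A (- \<mu>)) \<le> C / Re \<mu>))"

definition individually_eventually_positive ::
    "(real \<Rightarrow> 'a::banach_lattice complexification \<Rightarrow> 'a complexification) \<Rightarrow> bool" where
  "individually_eventually_positive T \<longleftrightarrow>
     (\<forall>x\<in>positive_cone. \<exists>t\<^sub>x\<ge>0. \<forall>t\<ge>t\<^sub>x. T t x \<in> positive_cone)"

end

theory Submission
  imports Defs
begin

text \<open>Let \<open>K\<close> be the closed convex cone of vectors whose whole orbit is positive. The resolvent
  \<open>R \<sigma>\<close> of the generator at \<open>\<sigma> > 0\<close> maps \<open>K\<close> into itself: for large \<open>\<sigma>\<close> because it is the Laplace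
  transform of the semigroup, and for all \<open>\<sigma> > 0\<close> because, by the Neumann series and the Kreiss bound
  \<open>C / \<sigma>\<close>, invariance at \<open>\<sigma>\<close> passes to \<open>\<sigma> (1 - 1 / (2 C))\<close>. For \<open>y \<in> K\<close> the integral of
  \<open>exp (- \<sigma> u) T u y\<close> over \<open>[0, n]\<close> is therefore dominated by \<open>R \<sigma> y\<close>; as the norm is additive on
  the cone, \<open>\<sigma> = 1 / n\<close> shows that the sum of \<open>\<parallel>T k y\<parallel>\<close> over \<open>k \<le> n\<close> is at most a constant times
  \<open>n \<parallel>y\<parallel>\<close>. Every positive vector enters \<open>K\<close> after finite time, so these Cesaro means are
  bounded on each orbit, and the uniform boundedness principle makes the bound uniform: the sum of
  \<open>\<parallel>T k x\<parallel>\<close> over \<open>k \<le> n\<close> is at most \<open>C n \<parallel>x\<parallel>\<close> for all \<open>x\<close>. Applied to all the tails of an orbit, this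
  gains a factor \<open>n powr (1 / C)\<close> over linear growth.\<close>

section \<open>Functional analysis and summation\<close>

text \<open>Baire category applied to the sublevel sets \<open>E n\<close>. Seminorms rather than
  operators appear because the result is also applied to averages of orbit norms.\<close>

lemma uniform_boundedness_seminorms:
  fixes p :: "'i \<Rightarrow> 'a::banach \<Rightarrow> real"
  assumes cont: "\<And>i. i \<in> I \<Longrightarrow> continuous_on UNIV (p i)"
    and tri: "\<And>i x y. i \<in> I \<Longrightarrow> p i (x + y) \<le> p i x + p i y"
    and hom: "\<And>i r x. i \<in> I \<Longrightarrow> p i (r *\<^sub>R x) = \<bar>r\<bar> * p i x"
    and bdd: "\<And>x. \<exists>B. \<forall>i\<in>I. p i x \<le> B"
  shows "\<exists>C. \<forall>i\<in>I. \<forall>x. p i x \<le> C * norm x"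
proof -
  define E where "E n = {x. \<forall>i\<in>I. p i x \<le> real n}" for n :: nat
  have closed: "closed (E n)" for n
  proof -
    have "closed {x. p i x \<le> real n}" if "i \<in> I" for i
      using continuous_on_closed_Collect_le[OF cont[OF that] continuous_on_const closed_UNIV] by simp
    then have "closed (\<Inter>i\<in>I. {x. p i x \<le> real n})" by auto
    moreover have "E n = (\<Inter>i\<in>I. {x. p i x \<le> real n})" by (auto simp: E_def)
    ultimately show ?thesis by simp
  qed
  have "(\<Union>n. E n) = UNIV"
  proof -
    have "x \<in> (\<Union>n. E n)" for x
    proof -
      obtain B where B: "\<forall>i\<in>I. p i x \<le> B" using bdd by blast
      obtain n where "B \<le> real n" using real_arch_simple by blast
      then have "x \<in> E n" using B by (force simp: E_def)
      then show ?thesis by blast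
    qed
    then show ?thesis by blast
  qed
  then have "\<exists>n. interior (E n) \<noteq> {}"
    using Met_TC.metric_Baire_category_alt[where 'a='a, of "range E"] closed
    by (fastforce simp: complete_UNIV)
  then obtain n x0 where "x0 \<in> interior (E n)" by blast
  then obtain r where r: "r > 0" "ball x0 r \<subseteq> E n" by (auto simp: mem_interior)
  have x0: "x0 \<in> E n" using r by auto
  have "p i x \<le> (4 * n / r) * norm x" if i: "i \<in> I" for i x
  proof (cases "x = 0")
    case True
    then show ?thesis using hom[OF i, of 0 0] by simp
  next
    case False
    \<comment> \<open>Since \<open>v\<close> has norm \<open>r / 2\<close>, \<open>p i v\<close> is
      at most \<open>p i (x0 + v) + p i (- x0)\<close>, hence at most \<open>2 * n\<close>;
      rescaling to \<open>x\<close> gives the constant \<open>4 * n / r\<close>.\<close>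
    define v where "v = (r / (2 * norm x)) *\<^sub>R x"
    have "norm v < r" using r False by (simp add: v_def)
    then have "x0 + v \<in> E n" using r by (auto simp: dist_norm)
    then have "p i (x0 + v) \<le> n" "p i x0 \<le> n" using x0 i by (auto simp: E_def)
    moreover have "p i (- x0) = p i x0" using hom[OF i, of "-1" x0] by simp
    ultimately have "p i v \<le> 2 * n" using tri[OF i, of "x0 + v" "- x0"] by simp
    moreover have "p i v = r / (2 * norm x) * p i x" using r by (simp add: v_def hom[OF i])
    ultimately show ?thesis using r False by (simp add: field_simps)
  qed
  then show ?thesis by blast
qed

text \<open>Riemann sums with tags in \<open>{a..b}\<close> combine points of \<open>K\<close> with
  nonnegative weights; closedness passes to the limit.\<close>

lemma integral_in_closed_convex_cone:
  fixes f :: "real \<Rightarrow> 'a::real_normed_vector"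
  assumes f: "(f has_integral y) {a..b}" and mem: "\<And>u. u \<in> {a..b} \<Longrightarrow> f u \<in> K"
    and K: "closed K" "0 \<in> K" "\<And>x y. x \<in> K \<Longrightarrow> y \<in> K \<Longrightarrow> x + y \<in> K"
      "\<And>c x. 0 \<le> c \<Longrightarrow> x \<in> K \<Longrightarrow> c *\<^sub>R x \<in> K"
  shows "y \<in> K"
proof -
  have "\<exists>z\<in>K. dist z y < e" if "e > 0" for e
  proof -
    obtain \<gamma> where \<gamma>: "gauge \<gamma>" "\<And>\<D>. \<D> tagged_division_of {a..b} \<Longrightarrow> \<gamma> fine \<D> \<Longrightarrow>
        norm (sum (\<lambda>(x,k). measure lborel k *\<^sub>R f x) \<D> - y) < e"
      using f \<open>e > 0\<close> unfolding has_integral_real by metis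
    obtain \<D> where \<D>: "\<D> tagged_division_of {a..b}" "\<gamma> fine \<D>"
      using fine_division_exists_real[OF \<gamma>(1)] by blast
    have "sum (\<lambda>(x,k). measure lborel k *\<^sub>R f x) \<D> \<in> K"
    proof -
      have K_sum: "sum g S \<in> K" if "finite S" "\<And>s. s \<in> S \<Longrightarrow> g s \<in> K" for g :: "real \<times> real set \<Rightarrow> 'a" and S
        using that by (induction S rule: finite_induct) (auto intro: K)
      show ?thesis
      proof (rule K_sum)
        show "finite \<D>" using \<D>(1) by (rule tagged_division_of_finite)
        show "(case s of (x, k) \<Rightarrow> measure lborel k *\<^sub>R f x) \<in> K" if "s \<in> \<D>" for s
          using that tag_in_interval[OF \<D>(1)] by (cases s) (auto intro!: K(4) mem)
      qed
    qed
    then show ?thesis using \<gamma>(2)[OF \<D>] by (auto simp: dist_norm)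
  qed
  then show ?thesis using \<open>closed K\<close> by (metis closed_approachable)
qed

text \<open>Young's inequality for \<open>(1 + x) powr \<delta> * 1 powr (1 - \<delta>)\<close>; a
  form of Bernoulli's inequality.\<close>

lemma powr_one_plus_le:
  fixes x \<delta> :: real
  assumes "0 \<le> x" "0 \<le> \<delta>" "\<delta> \<le> 1"
  shows "(1 + x) powr \<delta> \<le> 1 + \<delta> * x"
  using Youngs_inequality_0[of \<delta> "1 - \<delta>" "1 + x" 1] assms by (simp add: algebra_simps)

text \<open>The sum \<open>S m\<close> of the last \<open>m + 1\<close> terms satisfies \<open>(1 + 1 / (C (m + 1))) S m \<le> S (m + 1)\<close>, so
  \<open>f n = S 0\<close> is smaller than \<open>S n\<close> by a factor comparable to \<open>n powr (1 / C)\<close>.\<close>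

lemma power_gain_of_tail_sums:
  fixes f :: "nat \<Rightarrow> real"
  assumes C: "1 \<le> C" and f: "\<And>k. 0 \<le> f k"
    and tail: "\<And>j m. (\<Sum>k<m. f (j + Suc k)) \<le> C * real m * f j"
  shows "f n \<le> C * (1 + real n) powr (1 - 1 / C) * f 0"
proof -
  define S where "S m = (\<Sum>k\<le>m. f (n - m + k))" for m
  have step: "S (Suc m) \<ge> (1 + 1 / (C * real (Suc m))) * S m" if "Suc m \<le> n" for m
  proof -
    \<comment> \<open>Subtraction truncates, so \<open>Suc m \<le> n\<close> is needed to recognise
      \<open>S m\<close> as the sum that \<open>tail\<close> bounds at
      \<open>j = n - Suc m\<close>.\<close>
    have eq: "S m = (\<Sum>k<Suc m. f ((n - Suc m) + Suc k))"
      unfolding S_def lessThan_Suc_atMost using that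
      by (intro sum.cong arg_cong[of _ _ f]) auto
    have "S (Suc m) = f (n - Suc m) + (\<Sum>k\<le>m. f (n - Suc m + Suc k))"
      unfolding S_def by (subst sum.atMost_Suc_shift) simp
    then have "S (Suc m) = f (n - Suc m) + S m" by (simp add: eq lessThan_Suc_atMost)
    moreover have "S m \<le> C * real (Suc m) * f (n - Suc m)" unfolding eq by (rule tail)
    then have "S m / (C * real (Suc m)) \<le> f (n - Suc m)" using C
      by (simp add: pos_divide_le_eq mult.commute del: of_nat_Suc)
    ultimately show ?thesis by (simp add: algebra_simps)
  qed
  have "f n * (1 + real m) powr (1 / C) \<le> S m" if "m \<le> n" for m
    using that
  proof (induction m)
    case 0
    then show ?case by (simp add: S_def)
  next
    case (Suc m)
    have "(1 + real (Suc m)) = (1 + 1 / real (Suc m)) * (1 + real m)"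
      by (simp add: field_simps)
    then have "(1 + real (Suc m)) powr (1 / C) = (1 + 1 / real (Suc m)) powr (1 / C) * (1 + real m) powr (1 / C)"
      by (simp add: powr_mult)
    \<comment> \<open>Bernoulli with exponent \<open>1 / C\<close> produces exactly the growth
      factor of \<open>S\<close> from \<open>step\<close>.\<close>
    also have "\<dots> \<le> (1 + 1 / (C * real (Suc m))) * (1 + real m) powr (1 / C)"
      using powr_one_plus_le[of "1 / real (Suc m)" "1 / C"] C by (intro mult_right_mono) auto
    finally have "f n * (1 + real (Suc m)) powr (1 / C) \<le>
        (1 + 1 / (C * real (Suc m))) * (f n * (1 + real m) powr (1 / C))"
      using f[of n] by (simp add: mult_left_mono mult.left_commute)
    also have "\<dots> \<le> (1 + 1 / (C * real (Suc m))) * S m"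
      using Suc C by (intro mult_left_mono) (auto intro!: add_nonneg_nonneg)
    also have "\<dots> \<le> S (Suc m)" using step Suc by blast
    finally show ?case .
  qed
  from this[of n] have "f n * (1 + real n) powr (1 / C) \<le> S n" by simp
  also have "S n = f 0 + (\<Sum>k<n. f (0 + Suc k))"
    unfolding S_def by (cases n) (auto simp: sum.atMost_Suc_shift lessThan_Suc_atMost simp del: sum.atMost_Suc)
  also have "\<dots> \<le> C * f 0 + C * real n * f 0"
    using tail[of 0 n] C f[of 0] by (intro add_mono) (auto simp: mult_le_cancel_right1)
  also have "\<dots> = C * (1 + real n) powr (1 - 1 / C) * f 0 * (1 + real n) powr (1 / C)"
  proof -
    have "(1 + real n) powr (1 - 1 / C) * (1 + real n) powr (1 / C) = 1 + real n"
      by (simp add: powr_add[symmetric])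
    then show ?thesis by (simp add: algebra_simps)
  qed
  finally show ?thesis by (rule mult_right_le_imp_le) simp
qed


section \<open>Positive cones and (AL)-spaces\<close>

lemma bounded_linear_re_part: "bounded_linear (re_part :: 'a::banach_lattice complexification \<Rightarrow> 'a)"
  by (rule bounded_linear_intro[of _ 1]) (auto simp: complexification_simps norm_re_part_le)

lemma bounded_linear_im_part: "bounded_linear (im_part :: 'a::banach_lattice complexification \<Rightarrow> 'a)"
  by (rule bounded_linear_intro[of _ 1]) (auto simp: complexification_simps norm_im_part_le)

lemma positive_cone_iff: "z \<in> positive_cone \<longleftrightarrow> im_part z = 0 \<and> 0 \<le> re_part z"
  by (cases z) (auto simp: positive_cone_def)

lemma closed_positive_cone: "closed (positive_cone :: 'a::banach_lattice complexification set)"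
  unfolding closed_sequential_limits
proof (intro allI impI, elim conjE)
  fix X :: "nat \<Rightarrow> 'a complexification" and z
  assume X: "\<forall>n. X n \<in> positive_cone" "X \<longlonglongrightarrow> z"
  have "(\<lambda>n. re_part (X n)) \<longlonglongrightarrow> re_part z" "(\<lambda>n. im_part (X n)) \<longlonglongrightarrow> im_part z"
    using X(2) bounded_linear.tendsto bounded_linear_re_part bounded_linear_im_part by blast+
  with X(1) show "z \<in> positive_cone"
    using banach_lattice_nonneg_closed[of "\<lambda>n. re_part (X n)" "re_part z"]
    by (auto simp: positive_cone_iff LIMSEQ_const_iff)
qed

lemma positive_cone_0: "0 \<in> positive_cone"
  by (simp add: positive_cone_iff complexification_simps)

lemma positive_cone_add: "z \<in> positive_cone \<Longrightarrow> w \<in> positive_cone \<Longrightarrow> z + w \<in> positive_cone"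
  by (auto simp: positive_cone_iff complexification_simps)

lemma positive_cone_scaleR: "0 \<le> c \<Longrightarrow> z \<in> positive_cone \<Longrightarrow> c *\<^sub>R z \<in> positive_cone"
  by (auto simp: positive_cone_iff complexification_simps scaleR_nonneg_nonneg)

text \<open>Positive and negative parts of the real and imaginary part; this reduces estimates to
  the cone. The signs occur because \<open>nprt\<close> is nonpositive.\<close>

lemma complexification_decomposition:
  fixes z :: "'a::banach_lattice complexification"
  obtains a b c d where "a \<in> positive_cone" "b \<in> positive_cone" "c \<in> positive_cone" "d \<in> positive_cone"
    "z = (a - b) + \<i> *\<^sub>C (c - d)"
proof
  let ?a = "Cplx (pprt (re_part z)) 0" and ?b = "Cplx (- nprt (re_part z)) 0"
    and ?c = "Cplx (pprt (im_part z)) 0" and ?d = "Cplx (- nprt (im_part z)) 0"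
  show "?a \<in> positive_cone" "?b \<in> positive_cone" "?c \<in> positive_cone" "?d \<in> positive_cone"
    by (auto simp: positive_cone_iff)
  show "z = (?a - ?b) + \<i> *\<^sub>C (?c - ?d)"
    by (cases z) (simp add: complexification_simps scaleC_complexification_def prts[symmetric])
qed

text \<open>The linear extension of the norm from the cone, where it is additive.\<close>

definition al_functional :: "'a::al_space \<Rightarrow> real" where
  "al_functional x = norm (pprt x) - norm (nprt x)"

text \<open>Independence of the chosen difference of positive vectors:
  \<open>a - nprt x = b + pprt x\<close> for \<open>x = a - b\<close>, and norms add on the cone.
  Linearity follows from this.\<close>

lemma al_functional_diff:
  assumes "0 \<le> a" "0 \<le> b"
  shows "al_functional (a - b) = norm a - norm b"
proof -
  define x where "x = a - b"
  have "a - b = pprt x + nprt x" unfolding x_def by (rule prts)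
  then have "a + (- nprt x) = b + pprt x" by (simp add: algebra_simps)
  then have "norm a + norm (- nprt x) = norm b + norm (pprt x)"
    using assms by (metis neg_0_le_iff_le norm_add_nonneg nprt_le_zero zero_le_pprt)
  then show ?thesis by (simp add: al_functional_def x_def)
qed

lemma bounded_linear_al_functional: "bounded_linear al_functional"
proof (rule bounded_linear_intro[of _ 2])
  have decomp: "\<exists>a b. 0 \<le> a \<and> 0 \<le> b \<and> x = a - b" for x :: 'a
    using prts[of x] nprt_le_zero[of x] zero_le_pprt[of x]
    by (metis diff_minus_eq_add neg_0_le_iff_le)
  show add: "al_functional (x + y) = al_functional x + al_functional y" for x y :: 'a
  proof -
    obtain a b c d where *: "0 \<le> a" "0 \<le> b" "x = a - b" "0 \<le> c" "0 \<le> d" "y = c - d"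
      using decomp by metis
    then have "x + y = (a + c) - (b + d)" by simp
    then show ?thesis using * by (simp only: al_functional_diff norm_add_nonneg add_nonneg_nonneg)
  qed
  show "al_functional (r *\<^sub>R x) = r *\<^sub>R al_functional x" for r and x :: 'a
  proof -
    obtain a b where *: "0 \<le> a" "0 \<le> b" "x = a - b" using decomp by metis
    show ?thesis
    proof (cases "0 \<le> r")
      case True
      have "r *\<^sub>R x = r *\<^sub>R a - r *\<^sub>R b" unfolding \<open>x = a - b\<close> by (simp add: algebra_simps)
      then have "al_functional (r *\<^sub>R x) = norm (r *\<^sub>R a) - norm (r *\<^sub>R b)"
        using * True by (simp only: al_functional_diff scaleR_nonneg_nonneg)
      moreover have "al_functional x = norm a - norm b" using * by (simp only: al_functional_diff)
      ultimately show ?thesis using True by (simp add: right_diff_distrib)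
    next
      case False
      \<comment> \<open>A negative scalar exchanges the two positive vectors.\<close>
      have "r *\<^sub>R x = (- r) *\<^sub>R b - (- r) *\<^sub>R a" unfolding \<open>x = a - b\<close> by (simp add: algebra_simps)
      then have "al_functional (r *\<^sub>R x) = norm ((- r) *\<^sub>R b) - norm ((- r) *\<^sub>R a)"
        using * False by (simp only: al_functional_diff scaleR_nonneg_nonneg)
      moreover have "al_functional x = norm a - norm b" using * by (simp only: al_functional_diff)
      ultimately show ?thesis using False by (simp add: right_diff_distrib)
    qed
  qed
  show "norm (al_functional x) \<le> norm x * 2" for x :: 'a
  proof -
    have "\<bar>x\<bar> = pprt x + (- nprt x)" by (simp add: abs_prts)
    then have "norm \<bar>x\<bar> = norm (pprt x) + norm (nprt x)"
      by (metis neg_0_le_iff_le norm_add_nonneg norm_minus_cancel nprt_le_zero zero_le_pprt)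
    moreover have "norm \<bar>x\<bar> \<le> norm x" by (rule norm_mono_abs) simp
    ultimately show ?thesis using norm_ge_zero[of x] norm_ge_zero[of "pprt x"] norm_ge_zero[of "nprt x"]
      unfolding al_functional_def real_norm_def by linarith
  qed
qed

lemma al_functional_positive_cone:
  "z \<in> positive_cone \<Longrightarrow> al_functional (re_part z) = norm z"
  using al_functional_diff[of "re_part z" 0] by (cases z) (auto simp: positive_cone_iff norm_Cplx_real)


section \<open>Bounds and orbits of semigroups\<close>

locale c0_semigroup =
  fixes T :: "real \<Rightarrow> 'a::complex_banach \<Rightarrow> 'a"
  assumes C0: "C0_semigroup T"
begin

lemma T_bounded_linear: "0 \<le> t \<Longrightarrow> bounded_linear (T t)"
  using C0 by (auto simp: C0_semigroup_def bounded_clinear_def)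

lemma T_scaleC: "0 \<le> t \<Longrightarrow> T t (c *\<^sub>C x) = c *\<^sub>C T t x"
  using C0 by (auto simp: C0_semigroup_def bounded_clinear_def)

lemma T_0 [simp]: "T 0 x = x"
  using C0 by (simp add: C0_semigroup_def)

lemma T_add: "0 \<le> s \<Longrightarrow> 0 \<le> t \<Longrightarrow> T (s + t) x = T s (T t x)"
  using C0 by (simp add: C0_semigroup_def)

lemma T_tendsto_0: "((\<lambda>t. T t x) \<longlongrightarrow> x) (at_right 0)"
  using C0 by (simp add: C0_semigroup_def)

lemma T_linear:
  assumes "0 \<le> t"
  shows "T t (x + y) = T t x + T t y" "T t (x - y) = T t x - T t y"
    "T t (r *\<^sub>R x) = r *\<^sub>R T t x" "T t 0 = 0"
proof -
  interpret bounded_linear "T t" using assms by (rule T_bounded_linear)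
  show "T t (x + y) = T t x + T t y" "T t (x - y) = T t x - T t y"
    "T t (r *\<^sub>R x) = r *\<^sub>R T t x" "T t 0 = 0"
    by (auto simp: add diff scaleR zero)
qed

section \<open>Bounds near zero and exponential bounds\<close>

lemma T_power_bound:
  assumes B: "\<And>x. norm (T s x) \<le> B * norm x" and "0 \<le> B" "0 \<le> s"
  shows "norm (T (real n * s) x) \<le> B ^ n * norm x"
proof (induction n)
  case (Suc n)
  have "norm (T (real (Suc n) * s) x) = norm (T s (T (real n * s) x))"
    using T_add[of s "real n * s" x] \<open>0 \<le> s\<close> by (simp add: algebra_simps)
  also have "\<dots> \<le> B * norm (T (real n * s) x)" by (rule B)
  also have "\<dots> \<le> B * (B ^ n * norm x)" using Suc \<open>0 \<le> B\<close> by (rule mult_left_mono)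
  finally show ?case by (simp add: mult.assoc)
qed simp

text \<open>Otherwise there are times \<open>\<tau> n\<close> tending to 0 at which no bound
  \<open>n * norm x\<close> holds, although each sequence \<open>T (\<tau> n) x\<close> converges;
  this contradicts uniform boundedness.\<close>

lemma T_bounded_near_0:
  "\<exists>\<delta>>0. \<exists>B\<ge>0. \<forall>t\<in>{0..\<delta>}. \<forall>x. norm (T t x) \<le> B * norm x"
proof (rule ccontr)
  assume contra: "\<not> ?thesis"
  have "\<exists>t\<in>{0..1 / real (Suc n)}. \<exists>x. \<not> norm (T t x) \<le> real n * norm x" for n
    using contra by (metis of_nat_0_le_iff of_nat_0_less_iff zero_less_Suc divide_pos_pos zero_less_one)
  then obtain \<tau> where \<tau>: "\<And>n. \<tau> n \<in> {0..1 / real (Suc n)}"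
    "\<And>n. \<exists>x. \<not> norm (T (\<tau> n) x) \<le> real n * norm x" by metis
  have lim: "\<tau> \<longlonglongrightarrow> 0"
    by (rule tendsto_sandwich[OF _ _ tendsto_const LIMSEQ_Suc[OF lim_1_over_n]])
       (use \<tau>(1) in \<open>auto simp: field_simps\<close>)
  have "\<exists>C. \<forall>n\<in>UNIV. \<forall>x. norm (T (\<tau> n) x) \<le> C * norm x"
  proof (rule uniform_boundedness_seminorms)
    fix n :: nat
    have \<tau>0: "0 \<le> \<tau> n" using \<tau>(1)[of n] by simp
    show "continuous_on UNIV (\<lambda>x. norm (T (\<tau> n) x))"
      by (intro continuous_on_norm linear_continuous_on T_bounded_linear \<tau>0)
    show "norm (T (\<tau> n) (x + y)) \<le> norm (T (\<tau> n) x) + norm (T (\<tau> n) y)" for x y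
      by (simp add: T_linear[OF \<tau>0] norm_triangle_ineq)
    show "norm (T (\<tau> n) (r *\<^sub>R x)) = \<bar>r\<bar> * norm (T (\<tau> n) x)" for r x
      by (simp add: T_linear[OF \<tau>0])
  next
    fix x
    have "(\<lambda>n. T (\<tau> n) x) \<longlonglongrightarrow> x"
    proof (rule LIMSEQ_I)
      fix e :: real assume "0 < e"
      then have "\<forall>\<^sub>F t in at_right 0. dist (T t x) x < e" using tendstoD[OF T_tendsto_0] by blast
      then obtain b where b: "b > 0" "\<And>t. 0 < t \<Longrightarrow> t < b \<Longrightarrow> dist (T t x) x < e"
        by (auto simp: eventually_at_right_field)
      have "\<forall>\<^sub>F n in sequentially. \<tau> n < b" using order_tendstoD(2)[OF lim] b by blast
      then obtain N where N: "\<And>n. n \<ge> N \<Longrightarrow> \<tau> n < b" by (auto simp: eventually_sequentially)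
      \<comment> \<open>The limit from the right says nothing about \<open>\<tau> n = 0\<close>,
        where \<open>T 0 x = x\<close> is used.\<close>
      have "norm (T (\<tau> n) x - x) < e" if "n \<ge> N" for n
        using b(2)[of "\<tau> n"] N[OF that] \<tau>(1)[of n] \<open>0 < e\<close>
        by (cases "\<tau> n = 0") (auto simp: dist_norm)
      then show "\<exists>N. \<forall>n\<ge>N. norm (T (\<tau> n) x - x) < e" by blast
    qed
    then have "Bseq (\<lambda>n. T (\<tau> n) x)" using convergentI convergent_imp_Bseq by blast
    then show "\<exists>B. \<forall>n\<in>UNIV. norm (T (\<tau> n) x) \<le> B" by (auto simp: Bseq_def)
  qed
  then obtain C where C: "\<And>n x. norm (T (\<tau> n) x) \<le> C * norm x" by auto
  obtain n where n: "C \<le> real n" using real_arch_simple by blast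
  obtain x where "\<not> norm (T (\<tau> n) x) \<le> real n * norm x" using \<tau>(2) by blast
  moreover have "C * norm x \<le> real n * norm x" using n by (intro mult_right_mono) auto
  ultimately show False using C[of n x] by linarith
qed

lemma T_bounded_unit_interval:
  "\<exists>M\<ge>1. \<forall>t\<in>{0..1}. \<forall>x. norm (T t x) \<le> M * norm x"
proof -
  obtain \<delta> B where \<delta>: "\<delta> > 0" and B: "B \<ge> 0" "\<And>t x. t \<in> {0..\<delta>} \<Longrightarrow> norm (T t x) \<le> B * norm x"
    using T_bounded_near_0 by metis
  obtain N where N: "1 / \<delta> < real N" using reals_Archimedean2 by blast
  then have N0: "N > 0" using \<delta> by (cases N) (auto simp: field_simps)
  have "norm (T t x) \<le> max 1 (B ^ N) * norm x" if "t \<in> {0..1}" for t x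
  proof -
    have "t / N \<le> 1 / N" using that by (simp add: divide_right_mono)
    also have "\<dots> \<le> \<delta>" using N N0 \<delta> by (simp add: field_simps)
    finally have "t / N \<in> {0..\<delta>}" using that by simp
    then have "norm (T (real N * (t / N)) x) \<le> B ^ N * norm x"
      using B by (intro T_power_bound) auto
    moreover have "B ^ N * norm x \<le> max 1 (B ^ N) * norm x" by (intro mult_right_mono) auto
    ultimately show ?thesis using N0 by simp
  qed
  then show ?thesis by (intro exI[of _ "max 1 (B ^ N)"]) auto
qed

text \<open>One fixed choice, shared by the growth bound, the threshold \<open>ln M\<close> for the
  resolvent and the final estimate; \<open>M \<ge> 1\<close> makes \<open>ln M\<close>
  nonnegative.\<close>

definition M :: real where
  "M = (SOME M. M \<ge> 1 \<and> (\<forall>t\<in>{0..1}. \<forall>x. norm (T t x) \<le> M * norm x))"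

lemma M: "M \<ge> 1" "0 \<le> t \<Longrightarrow> t \<le> 1 \<Longrightarrow> norm (T t x) \<le> M * norm x"
  using someI_ex[of "\<lambda>M. M \<ge> 1 \<and> (\<forall>t\<in>{0..1}. \<forall>x. norm (T t x) \<le> M * norm x)"]
    T_bounded_unit_interval unfolding M_def[symmetric] by auto

text \<open>Reduces real times to integer times, on which the sums of orbit norms live.\<close>

lemma T_bound_floor:
  assumes "0 \<le> t"
  shows "norm (T t x) \<le> M * norm (T (real (nat \<lfloor>t\<rfloor>)) x)"
proof -
  define n where "n = nat \<lfloor>t\<rfloor>"
  have n: "real n \<le> t" "t < real n + 1" using assms by (auto simp: n_def)
  have "T t x = T (t - n) (T n x)" using T_add[of "t - n" n x] n by simp
  moreover have "norm (T (t - n) (T n x)) \<le> M * norm (T n x)" using n by (intro M(2)) auto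
  ultimately show ?thesis by (simp add: n_def)
qed

lemma T_exp_bound:
  assumes "0 \<le> t"
  shows "norm (T t x) \<le> M * exp (t * ln M) * norm x"
proof -
  define n where "n = nat \<lfloor>t\<rfloor>"
  have n: "real n \<le> t" using assms by (auto simp: n_def)
  have "norm (T t x) \<le> M * norm (T (real n) x)" unfolding n_def by (rule T_bound_floor[OF assms])
  also have "\<dots> \<le> M * (M ^ n * norm x)"
    using T_power_bound[of 1 M n x] M by (intro mult_left_mono) auto
  also have "M ^ n = exp (n * ln M)" using M(1) by (simp add: exp_of_nat_mult)
  also have "M * (exp (n * ln M) * norm x) \<le> M * (exp (t * ln M) * norm x)"
    using M(1) n by (intro mult_left_mono mult_right_mono iffD2[OF exp_le_cancel_iff]) auto
  finally show ?thesis by simp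
qed

section \<open>Differentiability and integrals of orbits\<close>

lemma T_orbit_increment:
  assumes "0 \<le> s" "s < t" "t \<le> b"
  defines "B \<equiv> M * exp (b * ln M)"
  shows "norm (T t z - T s z - (t - s) *\<^sub>R T s w) \<le>
      B * (t - s) * norm ((T (t - s) z - z) /\<^sub>R (t - s) - w)"
    "norm (T t w - T s w) \<le> B * norm (T (t - s) w - w)"
proof -
  have s: "0 \<le> s" using assms by simp
  have Ts: "norm (T s x) \<le> B * norm x" for x
  proof -
    have "norm (T s x) \<le> M * exp (s * ln M) * norm x" by (rule T_exp_bound[OF s])
    also have "\<dots> \<le> B * norm x" unfolding B_def
      using M(1) assms by (intro mult_right_mono mult_left_mono iffD2[OF exp_le_cancel_iff]) auto
    finally show ?thesis .
  qed
  \<comment> \<open>Factoring out \<open>T s\<close>, bounded by \<open>B\<close>, moves the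
    increment to the interval from 0 to \<open>t - s\<close>.\<close>
  have split: "T t x = T s (T (t - s) x)" for x using T_add[of s "t - s" x] assms by simp
  have "T t z - T s z - (t - s) *\<^sub>R T s w = T s ((t - s) *\<^sub>R ((T (t - s) z - z) /\<^sub>R (t - s) - w))"
    using assms by (simp add: T_linear[OF s] split scaleR_diff_right)
  also have "norm \<dots> \<le> B * norm ((t - s) *\<^sub>R ((T (t - s) z - z) /\<^sub>R (t - s) - w))" by (rule Ts)
  finally show "norm (T t z - T s z - (t - s) *\<^sub>R T s w) \<le>
      B * (t - s) * norm ((T (t - s) z - z) /\<^sub>R (t - s) - w)" using assms by (simp add: mult.assoc)
  have "T t w - T s w = T s (T (t - s) w - w)" by (simp add: T_linear[OF s] split)
  then show "norm (T t w - T s w) \<le> B * norm (T (t - s) w - w)" using Ts by simp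
qed

text \<open>The generator only gives a right derivative at 0. For the left derivative at
  \<open>t\<close>, the earlier time is factored out and strong continuity moves the derivative on
  to \<open>t\<close>.\<close>

lemma orbit_has_vector_derivative:
  assumes z: "z \<in> generator_domain T" and t: "t \<in> {0..b}"
  shows "((\<lambda>s. T s z) has_vector_derivative T t (generator T z)) (at t within {0..b})"
proof -
  define w where "w = generator T z"
  define q where "q h = norm ((T h z - z) /\<^sub>R h - w) + norm (T h w - w)" for h
  define B where "B = M * exp (b * ln M)"
  have B: "B > 0" using M(1) by (simp add: B_def)
  have "((\<lambda>h. (T h z - z) /\<^sub>R h) \<longlongrightarrow> w) (at_right 0)"
    using z by (auto simp: generator_domain_def w_def generator_def tendsto_Lim)
  then have "(q \<longlongrightarrow> 0 + 0) (at_right 0)"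
    unfolding q_def by (intro tendsto_add tendsto_norm_zero LIM_zero T_tendsto_0)
  then have q: "(q \<longlongrightarrow> 0) (at_right 0)" by simp
  \<comment> \<open>\<open>a = r\<close> serves the right derivative, \<open>a = s\<close> the left
    one; \<open>q\<close> collects the errors of the difference quotient and of the change of base
    point.\<close>
  have incr: "norm (T s z - T r z - (s - r) *\<^sub>R T a w) \<le> B * (s - r) * q (s - r)"
    if "0 \<le> r" "r < s" "s \<le> b" "a = r \<or> a = s" for r s a
  proof -
    have 1: "norm (T s z - T r z - (s - r) *\<^sub>R T r w) \<le> B * (s - r) * norm ((T (s - r) z - z) /\<^sub>R (s - r) - w)"
      and 2: "norm (T s w - T r w) \<le> B * norm (T (s - r) w - w)"
      using T_orbit_increment[OF that(1-3)] by (auto simp: B_def)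
    have "norm (T s z - T r z - (s - r) *\<^sub>R T a w) =
        norm ((T s z - T r z - (s - r) *\<^sub>R T r w) - (s - r) *\<^sub>R (T a w - T r w))"
      by (simp add: algebra_simps)
    also have "\<dots> \<le> norm (T s z - T r z - (s - r) *\<^sub>R T r w) + (s - r) * norm (T a w - T r w)"
      using norm_triangle_ineq4 that by (smt (verit) norm_scaleR)
    also have "\<dots> \<le> B * (s - r) * norm ((T (s - r) z - z) /\<^sub>R (s - r) - w)
        + (s - r) * (B * norm (T (s - r) w - w))"
      using 1 2 that B by (intro add_mono mult_left_mono) auto
    finally show ?thesis by (simp add: q_def algebra_simps)
  qed
  have "\<exists>d>0. \<forall>s\<in>{0..b}. norm (s - t) < d \<longrightarrow>
      norm (T s z - T t z - (s - t) *\<^sub>R T t w) \<le> e * norm (s - t)" if "e > 0" for e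
  proof -
    have "\<forall>\<^sub>F h in at_right 0. q h < e / B" using order_tendstoD(2)[OF q] that B by simp
    then obtain d where d: "d > 0" "\<And>h. 0 < h \<Longrightarrow> h < d \<Longrightarrow> q h < e / B"
      by (auto simp: eventually_at_right_field)
    have key: "B * h * q h \<le> e * h" if "0 < h" "h < d" for h
    proof -
      have "B * q h \<le> e" using d(2)[OF that] B by (simp add: field_simps)
      then show ?thesis using that mult_right_mono[of "B * q h" e h] by (simp add: algebra_simps)
    qed
    have "norm (T s z - T t z - (s - t) *\<^sub>R T t w) \<le> e * norm (s - t)"
      if "s \<in> {0..b}" "norm (s - t) < d" for s
    proof -
      consider "s < t" | "s = t" | "s > t" by linarith
      then show ?thesis
      proof cases
        case 1
        have "norm (T s z - T t z - (s - t) *\<^sub>R T t w) = norm (T t z - T s z - (t - s) *\<^sub>R T t w)"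
          by (subst norm_minus_cancel[symmetric]) (simp add: algebra_simps)
        also have "\<dots> \<le> B * (t - s) * q (t - s)" using that t 1 by (intro incr) auto
        also have "\<dots> \<le> e * (t - s)" using that 1 by (intro key) auto
        finally show ?thesis using 1 by simp
      next
        case 3
        have "norm (T s z - T t z - (s - t) *\<^sub>R T t w) \<le> B * (s - t) * q (s - t)"
          using that t 3 by (intro incr) auto
        also have "\<dots> \<le> e * (s - t)" using that 3 by (intro key) auto
        finally show ?thesis using 3 by simp
      qed simp
    qed
    then show ?thesis using d(1) by blast
  qed
  then show ?thesis
    unfolding has_vector_derivative_def has_derivative_within_alt w_def[symmetric]
    by (auto intro: bounded_linear_scaleR_left)
qed


text \<open>Fundamental theorem of calculus for
  \<open>- (exp (- \<sigma> * u) *\<^sub>R T u z)\<close>; for \<open>z = R \<sigma> y\<close> this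
  is a truncated Laplace transform.\<close>

lemma orbit_integral:
  assumes z: "z \<in> generator_domain T" and "0 \<le> a" "a \<le> b"
    and y: "\<sigma> *\<^sub>R z - generator T z = y"
  shows "((\<lambda>u. exp (- \<sigma> * u) *\<^sub>R T u y) has_integral
      (exp (- \<sigma> * a) *\<^sub>R T a z - exp (- \<sigma> * b) *\<^sub>R T b z)) {a..b}"
proof -
  have "((\<lambda>u. - (exp (- \<sigma> * u) *\<^sub>R T u z)) has_vector_derivative exp (- \<sigma> * u) *\<^sub>R T u y)
      (at u within {a..b})" if u: "u \<in> {a..b}" for u
  proof -
    have "((\<lambda>s. T s z) has_vector_derivative T u (generator T z)) (at u within {a..b})"
      by (rule has_vector_derivative_within_subset[OF orbit_has_vector_derivative[of z u b]])
        (use z u assms in auto)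
    then have deriv: "((\<lambda>u. - (exp (- \<sigma> * u) *\<^sub>R T u z)) has_vector_derivative
        - (exp (- \<sigma> * u) *\<^sub>R T u (generator T z) + (- \<sigma> * exp (- \<sigma> * u)) *\<^sub>R T u z)) (at u within {a..b})"
      by (auto intro!: derivative_eq_intros)
    have Ty: "T u y = \<sigma> *\<^sub>R T u z - T u (generator T z)"
      using u assms by (simp add: y[symmetric] T_linear)
    have eq: "exp (- \<sigma> * u) *\<^sub>R T u y =
        - (exp (- \<sigma> * u) *\<^sub>R T u (generator T z) + (- \<sigma> * exp (- \<sigma> * u)) *\<^sub>R T u z)"
      unfolding Ty by (simp add: scaleR_diff_right mult.commute)
    show ?thesis using deriv by (simp only: eq)
  qed
  from fundamental_theorem_of_calculus[OF \<open>a \<le> b\<close> this]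
  show ?thesis by simp
qed

end


section \<open>Resolvents of Kreiss bounded semigroups\<close>

locale kreiss_semigroup = c0_semigroup +
  assumes Kreiss: "Kreiss_bounded T"
begin

text \<open>For the generator \<open>G\<close> and \<open>A = - G\<close>, the resolvent of
  \<open>A\<close> at \<open>- \<sigma>\<close> inverts \<open>G - \<sigma>\<close>; the sign on
  \<open>y\<close> turns it into the inverse of \<open>\<sigma> - G\<close>.\<close>

definition R :: "real \<Rightarrow> 'a \<Rightarrow> 'a" where
  "R \<sigma> y = resolvent (generator_domain T) (\<lambda>x. - generator T x) (- of_real \<sigma>) (- y)"

lemma resolvent_set_negative:
  "0 < \<sigma> \<Longrightarrow> - of_real \<sigma> \<in> resolvent_set (generator_domain T) (\<lambda>x. - generator T x)"
  using Kreiss by (auto simp: Kreiss_bounded_def Let_def)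

lemma shifted_generator_bij:
  assumes "0 < \<sigma>"
  shows "bij_betw (\<lambda>z. generator T z - \<sigma> *\<^sub>R z) (generator_domain T) UNIV"
    and "R \<sigma> y = the_inv_into (generator_domain T) (\<lambda>z. generator T z - \<sigma> *\<^sub>R z) (- y)"
proof -
  have "- of_real \<sigma> *\<^sub>C z - (- generator T z) = generator T z - \<sigma> *\<^sub>R z" for z
    using scaleC_of_real[of "- \<sigma>" z] by simp
  then have *: "(\<lambda>z. - of_real \<sigma> *\<^sub>C z - (- generator T z)) = (\<lambda>z. generator T z - \<sigma> *\<^sub>R z)" by blast
  show "bij_betw (\<lambda>z. generator T z - \<sigma> *\<^sub>R z) (generator_domain T) UNIV"
    using resolvent_set_negative[OF assms] by (simp only: resolvent_set_def * mem_Collect_eq)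
  show "R \<sigma> y = the_inv_into (generator_domain T) (\<lambda>z. generator T z - \<sigma> *\<^sub>R z) (- y)"
    by (simp only: R_def resolvent_def *)
qed

lemma R_solves:
  assumes "0 < \<sigma>"
  shows "R \<sigma> y \<in> generator_domain T" "\<sigma> *\<^sub>R R \<sigma> y - generator T (R \<sigma> y) = y"
proof -
  note bij = shifted_generator_bij(1)[OF assms]
  have "the_inv_into (generator_domain T) (\<lambda>z. generator T z - \<sigma> *\<^sub>R z) (- y) \<in> generator_domain T"
    using bij by (intro the_inv_into_into[OF bij_betw_imp_inj_on]) (auto simp: bij_betw_def)
  then show "R \<sigma> y \<in> generator_domain T" by (simp add: shifted_generator_bij(2)[OF assms])
  have "generator T (R \<sigma> y) - \<sigma> *\<^sub>R R \<sigma> y = - y"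
    unfolding shifted_generator_bij(2)[OF assms]
    using bij f_the_inv_into_f_bij_betw[of _ "generator_domain T" UNIV "- y"] by fast
  then show "\<sigma> *\<^sub>R R \<sigma> y - generator T (R \<sigma> y) = y"
    by (metis minus_diff_eq minus_minus)
qed

lemma R_unique:
  assumes "0 < \<sigma>" "z \<in> generator_domain T" "\<sigma> *\<^sub>R z - generator T z = y"
  shows "R \<sigma> y = z"
proof -
  have "generator T z - \<sigma> *\<^sub>R z = - y" using assms(3) by (metis minus_diff_eq)
  then show ?thesis
    using the_inv_into_f_f[OF bij_betw_imp_inj_on[OF shifted_generator_bij(1)[OF assms(1)]] assms(2)]
    by (simp add: shifted_generator_bij(2)[OF assms(1)])
qed

lemma R_bounded_linear:
  assumes "0 < \<sigma>"
  shows "bounded_linear (R \<sigma>)"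
proof -
  have "bounded_linear (resolvent (generator_domain T) (\<lambda>x. - generator T x) (- of_real \<sigma>))"
    using resolvent_set_negative[OF assms] by (auto simp: resolvent_set_def bounded_clinear_def)
  from bounded_linear_compose[OF this bounded_linear_minus[OF bounded_linear_ident]]
  show ?thesis by (simp add: R_def[abs_def])
qed

text \<open>The Kreiss bound at real points. A constant of at least 1 keeps the ratio
  \<open>1 - 1 / (2 * C)\<close> used in \<open>R_K\<close> positive.\<close>

lemma R_norm_bound: "\<exists>C\<ge>1. \<forall>\<sigma>>0. \<forall>y. norm (R \<sigma> y) \<le> C / \<sigma> * norm y"
proof -
  let ?Q = "resolvent (generator_domain T) (\<lambda>x. - generator T x)"
  obtain C where C: "\<And>\<mu>. 0 < Re \<mu> \<Longrightarrow> onorm (?Q (- \<mu>)) \<le> C / Re \<mu>"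
    using Kreiss by (auto simp: Kreiss_bounded_def Let_def)
  have "norm (R \<sigma> y) \<le> max 1 C / \<sigma> * norm y" if "0 < \<sigma>" for \<sigma> y
  proof -
    have "norm (R \<sigma> y) \<le> onorm (?Q (- of_real \<sigma>)) * norm y"
      using onorm[of "?Q (- of_real \<sigma>)" "- y"] resolvent_set_negative[OF that]
      by (auto simp: R_def resolvent_set_def bounded_clinear_def)
    also have "\<dots> \<le> max 1 C / \<sigma> * norm y"
    proof (rule mult_right_mono)
      have "onorm (?Q (- of_real \<sigma>)) \<le> C / \<sigma>" using C[of "of_real \<sigma>"] that by simp
      also have "\<dots> \<le> max 1 C / \<sigma>" using that by (intro divide_right_mono) auto
      finally show "onorm (?Q (- of_real \<sigma>)) \<le> max 1 C / \<sigma>" .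
    qed simp
    finally show ?thesis .
  qed
  then show ?thesis by (intro exI[of _ "max 1 C"]) auto
qed

end

section \<open>Resolvent invariance of the cone of vectors with orbit in \<open>P\<close>\<close>

locale kreiss_semigroup_cone = kreiss_semigroup +
  fixes P :: "'a set"
  assumes P_closed: "closed P" and P_0: "0 \<in> P"
    and P_add: "x \<in> P \<Longrightarrow> y \<in> P \<Longrightarrow> x + y \<in> P"
    and P_scaleR: "0 \<le> c \<Longrightarrow> x \<in> P \<Longrightarrow> c *\<^sub>R x \<in> P"
begin

text \<open>Eventual positivity does not make the positive cone invariant under the semigroup;
  passing to vectors with their whole orbit in \<open>P\<close> restores invariance.\<close>

definition K :: "'a set" where "K = {y. \<forall>u\<ge>0. T u y \<in> P}"

lemma K_closed: "closed K"
proof -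
  have "closed (T u -` P)" if "0 \<le> u" for u
    using P_closed by (rule continuous_closed_vimage)
      (simp add: linear_continuous_at T_bounded_linear that)
  then have "closed (\<Inter>u\<in>{0..}. T u -` P)" by auto
  moreover have "K = (\<Inter>u\<in>{0..}. T u -` P)" by (auto simp: K_def)
  ultimately show ?thesis by simp
qed

lemma K_0: "0 \<in> K"
  by (simp add: K_def T_linear P_0)

lemma K_add: "x \<in> K \<Longrightarrow> y \<in> K \<Longrightarrow> x + y \<in> K"
  by (simp add: K_def T_linear P_add)

lemma K_scaleR: "0 \<le> c \<Longrightarrow> x \<in> K \<Longrightarrow> c *\<^sub>R x \<in> K"
  by (simp add: K_def T_linear P_scaleR)

lemma T_K: "0 \<le> t \<Longrightarrow> x \<in> K \<Longrightarrow> T t x \<in> K"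
  by (simp add: K_def T_add[symmetric])

lemma K_subset_P: "x \<in> K \<Longrightarrow> x \<in> P"
  unfolding K_def by (metis (mono_tags, lifting) T_0 mem_Collect_eq order_refl)

text \<open>For \<open>\<sigma> > ln M\<close> the exponential outweighs the growth of the orbit, so
  \<open>R \<sigma> y\<close> is the limit of the integrals over \<open>{0..n}\<close>, which lie in
  \<open>K\<close>.\<close>

lemma R_K_large:
  assumes \<sigma>: "\<sigma> > ln M" "0 < \<sigma>" and y: "y \<in> K"
  shows "R \<sigma> y \<in> K"
proof -
  define z where "z = R \<sigma> y"
  have z: "z \<in> generator_domain T" "\<sigma> *\<^sub>R z - generator T z = y"
    using R_solves[OF \<sigma>(2)] by (auto simp: z_def)
  have Z_K: "z - exp (- \<sigma> * real n) *\<^sub>R T (real n) z \<in> K" for n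
  proof (rule integral_in_closed_convex_cone)
    show "((\<lambda>u. exp (- \<sigma> * u) *\<^sub>R T u y) has_integral (z - exp (- \<sigma> * real n) *\<^sub>R T (real n) z)) {0..real n}"
      using orbit_integral[OF z(1) _ _ z(2), of 0 "real n"] by simp
  qed (use y in \<open>auto intro: K_closed K_0 K_add K_scaleR T_K\<close>)
  have lim: "(\<lambda>n. z - exp (- \<sigma> * real n) *\<^sub>R T (real n) z) \<longlonglongrightarrow> z"
  proof -
    have "exp (ln M - \<sigma>) < 1" using \<sigma> by simp
    then have "(\<lambda>n. M * norm z * exp (ln M - \<sigma>) ^ n) \<longlonglongrightarrow> M * norm z * 0"
      by (intro tendsto_mult tendsto_const LIMSEQ_realpow_zero) auto
    then have lim0: "(\<lambda>n. M * norm z * exp (ln M - \<sigma>) ^ n) \<longlonglongrightarrow> 0" by simp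
    have "norm (exp (- \<sigma> * real n) *\<^sub>R T (real n) z) \<le> M * norm z * exp (ln M - \<sigma>) ^ n" for n
    proof -
      have "norm (exp (- \<sigma> * real n) *\<^sub>R T (real n) z) \<le> exp (- \<sigma> * real n) * (M * exp (real n * ln M) * norm z)"
        using T_exp_bound[of "real n" z] by simp
      also have "\<dots> = M * norm z * exp (real n * (ln M - \<sigma>))"
        by (simp add: algebra_simps exp_diff exp_minus exp_add field_simps)
      finally show ?thesis by (simp add: exp_of_nat_mult)
    qed
    then have "(\<lambda>n. exp (- \<sigma> * real n) *\<^sub>R T (real n) z) \<longlonglongrightarrow> 0"
      by (intro Lim_null_comparison[OF _ lim0] always_eventually) blast
    from tendsto_diff[OF tendsto_const[of z] this] show ?thesis by simp
  qed
  show ?thesis unfolding z_def[symmetric] by (rule closed_sequentially[OF K_closed Z_K lim])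
qed

text \<open>\<open>R \<mu> y\<close> is the fixed point of the contraction \<open>x \<mapsto> R \<sigma> (y + (\<sigma> - \<mu>) x)\<close>, which preserves \<open>K\<close>.\<close>

lemma R_K_step:
  assumes C: "1 \<le> C" "\<And>y. norm (R \<sigma> y) \<le> C / \<sigma> * norm y"
    and \<mu>: "0 < \<mu>" "\<mu> \<le> \<sigma>" "\<sigma> - \<mu> \<le> \<sigma> / (2 * C)"
    and inv: "\<And>y. y \<in> K \<Longrightarrow> R \<sigma> y \<in> K"
    and y: "y \<in> K"
  shows "R \<mu> y \<in> K"
proof -
  define h where "h = \<sigma> - \<mu>"
  define z where "z = R \<mu> y"
  \<comment> \<open>The iterates of the contraction from 0; \<open>h \<ge> 0\<close> keeps them in
    \<open>K\<close>.\<close>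
  define Z where "Z = rec_nat 0 (\<lambda>_ x. R \<sigma> (y + h *\<^sub>R x))"
  have \<sigma>: "0 < \<sigma>" using \<mu> by simp
  interpret RL: bounded_linear "R \<sigma>" by (rule R_bounded_linear[OF \<sigma>])
  \<comment> \<open>The contraction factor; the limit on the step size makes it at most
    \<open>1 / 2\<close>.\<close>
  have h: "0 \<le> h" "h * (C / \<sigma>) \<le> 1 / 2" using \<mu> \<sigma> C(1) by (auto simp: h_def field_simps)
  have Z_K: "Z n \<in> K" for n
    by (induction n) (auto simp: Z_def intro!: K_0 inv K_add y K_scaleR h)
  \<comment> \<open>Adding \<open>h *\<^sub>R z\<close> turns the equation of \<open>R \<mu>\<close>
    into one for \<open>R \<sigma>\<close>, as in the resolvent identity.\<close>
  have "\<sigma> *\<^sub>R z - generator T z = y + h *\<^sub>R z"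
    using R_solves(2)[OF \<mu>(1), of y] by (simp add: z_def h_def algebra_simps)
  then have z: "z = R \<sigma> (y + h *\<^sub>R z)"
    using R_unique[OF \<sigma>, of z] R_solves(1)[OF \<mu>(1), of y] by (simp add: z_def)
  have Z_bound: "norm (Z n - z) \<le> (1 / 2) ^ n * norm z" for n
  proof (induction n)
    case (Suc n)
    have "Z (Suc n) - z = R \<sigma> (y + h *\<^sub>R Z n) - R \<sigma> (y + h *\<^sub>R z)"
      unfolding Z_def by (simp flip: z)
    then have step: "Z (Suc n) - z = R \<sigma> (h *\<^sub>R (Z n - z))"
      by (simp add: RL.diff[symmetric] algebra_simps)
    have "norm (Z (Suc n) - z) \<le> C / \<sigma> * norm (h *\<^sub>R (Z n - z))"
      unfolding step by (rule C(2))
    then have "norm (Z (Suc n) - z) \<le> h * (C / \<sigma>) * norm (Z n - z)"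
      by (simp only: norm_scaleR abs_of_nonneg[OF h(1)] mult_ac)
    also have "\<dots> \<le> 1 / 2 * norm (Z n - z)" using h by (intro mult_right_mono) auto
    also have "\<dots> \<le> 1 / 2 * ((1 / 2) ^ n * norm z)" using Suc by (intro mult_left_mono) auto
    finally show ?case by simp
  qed (simp add: Z_def)
  have "(\<lambda>n. (1 / 2) ^ n * norm z) \<longlonglongrightarrow> 0 * norm z"
    by (intro tendsto_mult tendsto_const LIMSEQ_power_zero) auto
  then have lim0: "(\<lambda>n. (1 / 2) ^ n * norm z) \<longlonglongrightarrow> 0" by simp
  have "(\<lambda>n. Z n - z) \<longlonglongrightarrow> 0"
    by (rule Lim_null_comparison[OF always_eventually lim0]) (simp add: Z_bound)
  then have lim: "Z \<longlonglongrightarrow> z" by (simp add: LIM_zero_iff)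
  show ?thesis unfolding z_def[symmetric] by (rule closed_sequentially[OF K_closed Z_K lim])
qed

lemma R_K:
  assumes "0 < \<sigma>" "y \<in> K"
  shows "R \<sigma> y \<in> K"
proof -
  obtain C where C: "1 \<le> C" "\<And>\<sigma> y. 0 < \<sigma> \<Longrightarrow> norm (R \<sigma> y) \<le> C / \<sigma> * norm y"
    using R_norm_bound by metis
  \<comment> \<open>The longest step that \<open>R_K_step\<close> admits: from
    \<open>\<sigma> / q\<close> to \<open>\<sigma>\<close> the decrease is exactly
    \<open>(\<sigma> / q) / (2 * C)\<close>.\<close>
  define q where "q = 1 - 1 / (2 * C)"
  define \<sigma>0 where "\<sigma>0 = ln M + 1"
  have q: "0 < q" "q < 1" using C(1) by (auto simp: q_def field_simps)
  have "\<sigma>0 > 0" using M(1) by (simp add: \<sigma>0_def add_nonneg_pos)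
  \<comment> \<open>Geometric descent from \<open>\<sigma>0 > ln M\<close>; as \<open>q ^ k\<close>
    tends to 0, every positive \<open>\<sigma>\<close> is reached.\<close>
  have all: "R \<sigma> y \<in> K" if "0 < \<sigma>" "\<sigma>0 * q ^ k \<le> \<sigma>" "y \<in> K" for k \<sigma> y
    using that
  proof (induction k arbitrary: \<sigma> y)
    case 0
    then show ?case by (intro R_K_large) (auto simp: \<sigma>0_def)
  next
    case (Suc k)
    have "\<sigma>0 * q ^ k \<le> \<sigma> / q" using Suc.prems(2) q by (simp add: field_simps)
    then have inv: "R (\<sigma> / q) x \<in> K" if "x \<in> K" for x
      using Suc.IH[of "\<sigma> / q" x] that Suc.prems(1) q by simp
    have "\<sigma> / q - \<sigma> = (\<sigma> / q) * (1 - q)" using q by (simp add: field_simps)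
    also have "\<dots> = (\<sigma> / q) / (2 * C)" by (simp add: q_def)
    finally have "\<sigma> / q - \<sigma> \<le> (\<sigma> / q) / (2 * C)" by simp
    moreover have "\<sigma> \<le> \<sigma> / q" using q Suc.prems(1) by (simp add: field_simps)
    ultimately show ?case
      using q Suc.prems by (intro R_K_step[OF C(1) C(2)[of "\<sigma> / q"] _ _ _ inv]) auto
  qed
  obtain k where "q ^ k < \<sigma> / \<sigma>0"
    using real_arch_pow_inv[of "\<sigma> / \<sigma>0" q] q assms(1) \<open>\<sigma>0 > 0\<close> by auto
  then have "\<sigma>0 * q ^ k \<le> \<sigma>" using \<open>\<sigma>0 > 0\<close> by (simp add: field_simps)
  then show ?thesis using all assms by blast
qed

end


section \<open>Growth on (AL)-spaces\<close>

locale kreiss_al_semigroup = kreiss_semigroup T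
  for T :: "real \<Rightarrow> 'a::al_space complexification \<Rightarrow> 'a complexification" +
  assumes eventually_positive: "individually_eventually_positive T"
begin

sublocale kreiss_semigroup_cone T positive_cone
  by unfold_locales
    (auto intro: closed_positive_cone positive_cone_0 positive_cone_add positive_cone_scaleR)

text \<open>Integrate \<open>al_functional\<close>, the linear extension of the norm on the cone, along the orbit over
  \<open>[a, a + 1]\<close>, where \<open>\<parallel>T u y\<parallel> \<ge> \<parallel>T (a + 1) y\<parallel> / M\<close>.\<close>

lemma norm_decay_K:
  assumes \<sigma>: "0 < \<sigma>" and y: "y \<in> K" and "0 \<le> a"
  defines "g \<equiv> \<lambda>t. exp (- \<sigma> * t) * norm (T t (R \<sigma> y))"
  shows "exp (- \<sigma> * (a + 1)) * norm (T (a + 1) y) / M \<le> g a - g (a + 1)"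
proof -
  define z where "z = R \<sigma> y"
  define \<phi> :: "'a complexification \<Rightarrow> real" where "\<phi> = (\<lambda>w. al_functional (re_part w))"
  have z: "z \<in> generator_domain T" "\<sigma> *\<^sub>R z - generator T z = y" "z \<in> K"
    using R_solves[OF \<sigma>] R_K[OF \<sigma> y] by (auto simp: z_def)
  interpret \<phi>: bounded_linear \<phi>
    unfolding \<phi>_def by (rule bounded_linear_compose[OF bounded_linear_al_functional bounded_linear_re_part])
  have \<phi>_norm: "\<phi> (T t w) = norm (T t w)" if "0 \<le> t" "w \<in> K" for t w
    unfolding \<phi>_def using that T_K K_subset_P by (simp add: al_functional_positive_cone)
  have "((\<lambda>u. \<phi> (exp (- \<sigma> * u) *\<^sub>R T u y)) has_integral
      \<phi> (exp (- \<sigma> * a) *\<^sub>R T a z - exp (- \<sigma> * (a + 1)) *\<^sub>R T (a + 1) z)) {a..a + 1}"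
    using has_integral_linear[OF orbit_integral[OF z(1) \<open>0 \<le> a\<close> _ z(2), of "a + 1"] \<phi>.bounded_linear_axioms]
    by (simp add: o_def)
  \<comment> \<open>Invariance of \<open>K\<close> under \<open>R \<sigma>\<close> enters here:
    \<open>z \<in> K\<close> turns the boundary terms into norms, so consecutive intervals
    telescope.\<close>
  moreover have "\<phi> (exp (- \<sigma> * a) *\<^sub>R T a z - exp (- \<sigma> * (a + 1)) *\<^sub>R T (a + 1) z) = g a - g (a + 1)"
    unfolding \<phi>.diff \<phi>.scaleR using \<open>0 \<le> a\<close> z(3) by (simp add: \<phi>_norm g_def z_def)
  ultimately have int: "((\<lambda>u. \<phi> (exp (- \<sigma> * u) *\<^sub>R T u y)) has_integral g a - g (a + 1)) {a..a + 1}"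
    by (simp only:)
  have const: "((\<lambda>_. exp (- \<sigma> * (a + 1)) * norm (T (a + 1) y) / M) has_integral
      exp (- \<sigma> * (a + 1)) * norm (T (a + 1) y) / M) {a..a + 1}"
    using has_integral_const_real[of "exp (- \<sigma> * (a + 1)) * norm (T (a + 1) y) / M" a "a + 1"] by simp
  show ?thesis
  proof (rule has_integral_le[OF const int])
    fix u assume u: "u \<in> {a..a + 1}"
    have "norm (T (a + 1) y) = norm (T (a + 1 - u) (T u y))"
      using T_add[of "a + 1 - u" u y] u \<open>0 \<le> a\<close> by simp
    also have "\<dots> \<le> M * norm (T u y)" using u by (intro M(2)) auto
    finally have "norm (T (a + 1) y) / M \<le> norm (T u y)"
      using M(1) by (simp add: pos_divide_le_eq mult.commute)
    then have "exp (- \<sigma> * (a + 1)) * (norm (T (a + 1) y) / M) \<le> exp (- \<sigma> * u) * norm (T u y)"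
      using u \<sigma> M(1) by (intro mult_mono) auto
    also have "\<dots> = \<phi> (exp (- \<sigma> * u) *\<^sub>R T u y)"
      using u \<open>0 \<le> a\<close> y by (simp add: \<phi>.scaleR \<phi>_norm)
    finally show "exp (- \<sigma> * (a + 1)) * norm (T (a + 1) y) / M \<le> \<phi> (exp (- \<sigma> * u) *\<^sub>R T u y)"
      by simp
  qed
qed

lemma orbit_sum_K:
  "\<exists>C\<ge>0. \<forall>y\<in>K. \<forall>n. (\<Sum>k<n. norm (T (real (Suc k)) y)) \<le> C * real n * norm y"
proof -
  obtain C where C: "1 \<le> C" "\<And>\<sigma> y. 0 < \<sigma> \<Longrightarrow> norm (R \<sigma> y) \<le> C / \<sigma> * norm y"
    using R_norm_bound by metis
  have "(\<Sum>k<n. norm (T (real (Suc k)) y)) \<le> (exp 1 * M * C) * real n * norm y" if y: "y \<in> K" for y n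
  proof (cases "n = 0")
    case False
    \<comment> \<open>With this choice the weights up to time \<open>n\<close> are at least
      \<open>exp (- 1)\<close>, while the Kreiss bound \<open>C / \<sigma>\<close> is
      \<open>C * n\<close>.\<close>
    define \<sigma> where "\<sigma> = 1 / real n"
    have \<sigma>: "0 < \<sigma>" using False by (simp add: \<sigma>_def)
    define g where "g t = exp (- \<sigma> * t) * norm (T t (R \<sigma> y))" for t
    have term_le: "norm (T (real (Suc k)) y) \<le> exp 1 * M * (g (real k) - g (real (Suc k)))" if "k < n" for k
    proof -
      have "exp (- 1) * norm (T (real (Suc k)) y) / M \<le> exp (- \<sigma> * (real k + 1)) * norm (T (real (Suc k)) y) / M"
      proof (intro divide_right_mono mult_right_mono)
        have "\<sigma> * (real k + 1) \<le> 1" using that by (simp add: \<sigma>_def)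
        then show "exp (- 1) \<le> exp (- \<sigma> * (real k + 1))" by simp
      qed (use M(1) in auto)
      also have "\<dots> \<le> g (real k) - g (real (Suc k))"
        using norm_decay_K[OF \<sigma> y, of "real k"] by (simp add: g_def add.commute)
      finally show ?thesis using M(1) by (simp add: exp_minus field_simps)
    qed
    have "(\<Sum>k<n. norm (T (real (Suc k)) y)) \<le> (\<Sum>k<n. exp 1 * M * (g (real k) - g (real (Suc k))))"
      using term_le by (intro sum_mono) auto
    \<comment> \<open>The decay estimates over unit intervals telescope; the last term is
      nonnegative and is dropped next.\<close>
    also have "\<dots> = exp 1 * M * (g 0 - g (real n))"
      using sum_lessThan_telescope'[of "\<lambda>k. g (real k)" n] by (simp only: sum_distrib_left[symmetric] of_nat_0)
    also have "\<dots> \<le> exp 1 * M * (C / \<sigma> * norm y)"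
    proof (rule mult_left_mono)
      have "g 0 - g (real n) \<le> norm (R \<sigma> y)" by (simp add: g_def)
      then show "g 0 - g (real n) \<le> C / \<sigma> * norm y" using C(2)[OF \<sigma>, of y] by linarith
    qed (use M(1) in auto)
    finally show ?thesis by (simp add: \<sigma>_def mult.assoc)
  qed simp
  then show ?thesis using M(1) C(1) by (intro exI[of _ "exp 1 * M * C"]) auto
qed

text \<open>The orbit enters \<open>K\<close> at an integer time \<open>m\<close>, and the terms up
  to \<open>m\<close> contribute a constant. \<open>B\<close> depends on \<open>x\<close> through
  the entry time and these terms.\<close>

lemma orbit_sum_positive:
  assumes x: "x \<in> positive_cone"
  shows "\<exists>B. \<forall>n. (\<Sum>k<n. norm (T (real (Suc k)) x)) \<le> B * real n"
proof -
  obtain t where t: "0 \<le> t" "\<And>s. t \<le> s \<Longrightarrow> T s x \<in> positive_cone"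
    using x eventually_positive by (auto simp: individually_eventually_positive_def)
  obtain m where m: "t \<le> real m" using real_arch_simple by blast
  define y where "y = T (real m) x"
  have "T u y \<in> positive_cone" if "0 \<le> u" for u
    using t(2)[of "u + real m"] m that by (simp add: y_def T_add[symmetric])
  then have y: "y \<in> K" by (simp add: K_def)
  obtain C where C: "C \<ge> 0" "\<And>y n. y \<in> K \<Longrightarrow> (\<Sum>k<n. norm (T (real (Suc k)) y)) \<le> C * real n * norm y"
    using orbit_sum_K by metis
  define A where "A = (\<Sum>k<m. norm (T (real (Suc k)) x))"
  have A: "0 \<le> A" by (simp add: A_def sum_nonneg)
  have "(\<Sum>k<n. norm (T (real (Suc k)) x)) \<le> (A + C * norm y) * real n" for n
  proof (cases "n = 0")
    case False
    have "(\<Sum>k<n. norm (T (real (Suc k)) x)) \<le> (\<Sum>k<m + n. norm (T (real (Suc k)) x))"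
      by (intro sum_mono2) auto
    also have "\<dots> = A + (\<Sum>k<n. norm (T (real (Suc (m + k))) x))"
      unfolding A_def by (induction n) auto
    also have "(\<Sum>k<n. norm (T (real (Suc (m + k))) x)) = (\<Sum>k<n. norm (T (real (Suc k)) y))"
      by (intro sum.cong) (auto simp: y_def T_add[symmetric] algebra_simps)
    also have "\<dots> \<le> C * real n * norm y" by (rule C(2)[OF y])
    also have "A + C * real n * norm y \<le> A * real n + C * real n * norm y"
      using A False by (simp add: mult_le_cancel_left1)
    finally show ?thesis by (simp add: algebra_simps)
  qed simp
  then show ?thesis by blast
qed

text \<open>The decomposition extends the individual bounds from the cone to all vectors; uniform
  boundedness then makes the constant independent of the vector.\<close>

lemma orbit_sum_bound:
  "\<exists>C\<ge>0. \<forall>x n. (\<Sum>k<n. norm (T (real (Suc k)) x)) \<le> C * real n * norm x"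
proof -
  \<comment> \<open>Division by zero gives the value 0 at \<open>n = 0\<close>, so all naturals may
    serve as indices.\<close>
  define p where "p n x = (\<Sum>k<n. norm (T (real (Suc k)) x)) / real n" for n x
  have p_scaleC: "p n (c *\<^sub>C x) = cmod c * p n x" for n c x
    by (simp add: p_def T_scaleC norm_scaleC sum_distrib_left)
  have p_add: "p n (x + y) \<le> p n x + p n y" for n x y
    unfolding p_def add_divide_distrib[symmetric] sum.distrib[symmetric]
    by (intro divide_right_mono sum_mono) (auto simp: T_linear norm_triangle_ineq)
  have p_diff: "p n (x - y) \<le> p n x + p n y" for n x y
    unfolding p_def add_divide_distrib[symmetric] sum.distrib[symmetric]
    by (intro divide_right_mono sum_mono) (auto simp: T_linear norm_triangle_ineq4)
  have p_positive: "\<exists>B. \<forall>n. p n x \<le> B" if x: "x \<in> positive_cone" for x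
  proof -
    obtain B where B: "\<And>n. (\<Sum>k<n. norm (T (real (Suc k)) x)) \<le> B * real n"
      using orbit_sum_positive[OF x] by blast
    have "p n x \<le> max 0 B" for n
      using B[of n] by (cases "n = 0") (auto simp: p_def pos_divide_le_eq le_max_iff_disj)
    then show ?thesis by blast
  qed
  have "\<exists>C. \<forall>n\<in>UNIV. \<forall>x. p n x \<le> C * norm x"
  proof (rule uniform_boundedness_seminorms)
    show "continuous_on UNIV (p n)" for n
      unfolding p_def divide_inverse
      by (intro continuous_intros continuous_on_norm linear_continuous_on T_bounded_linear) auto
    show "p n (x + y) \<le> p n x + p n y" for n x y by (rule p_add)
    show "p n (r *\<^sub>R x) = \<bar>r\<bar> * p n x" for n r x
      using p_scaleC[of n "of_real r" x] by (simp add: scaleC_of_real)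
    show "\<exists>B. \<forall>n\<in>UNIV. p n z \<le> B" for z
    proof -
      obtain a b c d where pos: "a \<in> positive_cone" "b \<in> positive_cone" "c \<in> positive_cone" "d \<in> positive_cone"
        and z: "z = (a - b) + \<i> *\<^sub>C (c - d)" by (rule complexification_decomposition)
      obtain A where A: "\<forall>n. p n a \<le> A" using p_positive[OF pos(1)] by blast
      obtain B where B: "\<forall>n. p n b \<le> B" using p_positive[OF pos(2)] by blast
      obtain C where C: "\<forall>n. p n c \<le> C" using p_positive[OF pos(3)] by blast
      obtain D where D: "\<forall>n. p n d \<le> D" using p_positive[OF pos(4)] by blast
      have "p n z \<le> A + B + C + D" for n
        using p_add[of n "a - b" "\<i> *\<^sub>C (c - d)"] p_diff[of n a b] p_diff[of n c d]
          A[rule_format, of n] B[rule_format, of n] C[rule_format, of n] D[rule_format, of n]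
        by (simp add: z p_scaleC)
      then show ?thesis by blast
    qed
  qed
  then obtain C where C: "\<And>n x. p n x \<le> C * norm x" by auto
  have "(\<Sum>k<n. norm (T (real (Suc k)) x)) \<le> max 0 C * real n * norm x" for n x
  proof (cases "n = 0")
    case False
    then have "(\<Sum>k<n. norm (T (real (Suc k)) x)) \<le> C * norm x * real n"
      using C[of n x] by (simp add: p_def pos_divide_le_eq)
    also have "\<dots> \<le> max 0 C * norm x * real n" by (intro mult_right_mono) auto
    finally show ?thesis by (simp add: mult_ac)
  qed simp
  then show ?thesis by (intro exI[of _ "max 0 C"]) auto
qed

text \<open>The orbit after time \<open>j\<close> is the orbit of \<open>T j x\<close>; a sum bound
  uniform in the vector therefore controls all tails, as \<open>power_gain_of_tail_sums\<close>
  requires.\<close>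

lemma growth_bound:
  "\<exists>C>1. \<forall>t\<ge>0. \<forall>x. norm (T t x) \<le> M * C * (1 + t) powr (1 - 1 / C) * norm x"
proof -
  obtain C0 where C0: "C0 \<ge> 0" "\<And>x n. (\<Sum>k<n. norm (T (real (Suc k)) x)) \<le> C0 * real n * norm x"
    using orbit_sum_bound by metis
  \<comment> \<open>Adding 2 ensures \<open>C > 1\<close>, so the exponent \<open>1 - 1 / C\<close>
    lies strictly between 0 and 1.\<close>
  define C where "C = C0 + 2"
  have C1: "C > 1" using C0(1) by (simp add: C_def)
  have tail: "(\<Sum>k<n. norm (T (real (Suc k)) x)) \<le> C * real n * norm x" for x n
  proof -
    have "C0 * real n * norm x \<le> C * real n * norm x" unfolding C_def by (intro mult_right_mono) auto
    then show ?thesis using C0(2)[where n = n and x = x] by linarith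
  qed
  have "norm (T t x) \<le> M * C * (1 + t) powr (1 - 1 / C) * norm x" if "0 \<le> t" for t x
  proof -
    define n where "n = nat \<lfloor>t\<rfloor>"
    have n: "real n \<le> t" using that by (simp add: n_def)
    have "norm (T (real n) x) \<le> C * (1 + real n) powr (1 - 1 / C) * norm (T (real 0) x)"
    proof (rule power_gain_of_tail_sums)
      show "(\<Sum>k<m. norm (T (real (j + Suc k)) x)) \<le> C * real m * norm (T (real j) x)" for j m
        using tail[where n = m and x = "T (real j) x"] by (simp add: T_add[symmetric] algebra_simps)
    qed (use C1 in auto)
    also have "\<dots> \<le> C * (1 + t) powr (1 - 1 / C) * norm x"
      using C1 n that by (auto intro!: mult_right_mono mult_left_mono powr_mono2)
    finally have "M * norm (T (real n) x) \<le> M * (C * (1 + t) powr (1 - 1 / C) * norm x)"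
      using M(1) by (intro mult_left_mono) auto
    then show ?thesis using T_bound_floor[OF that, of x] by (simp add: n_def mult.assoc)
  qed
  then show ?thesis using C1 by blast
qed

end

theorem theorem4p1:
  fixes T :: "real \<Rightarrow> 'a::al_space complexification \<Rightarrow> 'a complexification"
  assumes "C0_semigroup T"
    and "individually_eventually_positive T"
    and "Kreiss_bounded T"
  shows "\<exists>\<epsilon>\<in>{0<..<1}. (\<lambda>t. onorm (T t)) \<in> O[at_top](\<lambda>t. t powr (1 - \<epsilon>))"
proof -
  interpret kreiss_al_semigroup T
    using assms by unfold_locales
  obtain C where C: "C > 1"
      "\<And>t x. 0 \<le> t \<Longrightarrow> norm (T t x) \<le> M * C * (1 + t) powr (1 - 1 / C) * norm x"
    using growth_bound by metis
  have "norm (onorm (T t)) \<le> (M * C * 2 powr (1 - 1 / C)) * norm (t powr (1 - 1 / C))"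
    if t: "1 \<le> t" for t
  proof -
    have "onorm (T t) \<le> M * C * (1 + t) powr (1 - 1 / C)"
      using C t M(1) by (intro onorm_bound) auto
    \<comment> \<open>\<open>1 + t \<le> 2 * t\<close> because \<open>t \<ge> 1\<close>; the
      exponent is nonnegative.\<close>
    also have "\<dots> \<le> M * C * (2 * t) powr (1 - 1 / C)"
      using C(1) t M(1) by (intro mult_left_mono powr_mono2) auto
    also have "\<dots> = (M * C * 2 powr (1 - 1 / C)) * t powr (1 - 1 / C)"
      using t by (simp add: powr_mult)
    finally show ?thesis
      using t onorm_pos_le[OF T_bounded_linear[of t]] by simp
  qed
  then have "(\<lambda>t. onorm (T t)) \<in> O[at_top](\<lambda>t. t powr (1 - 1 / C))"
    by (intro bigoI[of _ "M * C * 2 powr (1 - 1 / C)"] eventually_mono[OF eventually_ge_at_top[of 1]])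
  moreover have "1 / C \<in> {0<..<1}" using C(1) by simp
  ultimately show ?thesis by blast
qed

end
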